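(* Let $\mathcal X$ be an RD-space, let $\rho$ be an admissible function on $\mathcal X$, let $\epsilon_1\in(0,1]$, $\epsilon_2\in(0,\infty)$, let $\{S_t\}_{t>0}$ be a continuous approximation of the identity of order $(\epsilon_1,\epsilon_2)$, and let $S^+_\rho(f)(x)=\sup_{0<t<\rho(x)}|S_t(f)(x)|$ for $x\in\mathcal X$. Then there exists a positive constant $C$ such that for all $f\in\mathrm{BMO}_\rho(\mathcal X)$, $S^+_\rho(f)\in\mathrm{BLO}_\rho(\mathcal X)$ and $$\|S^+_\rho(f)\|_{\mathrm{BLO}_\rho(\mathcal X)}\le C\|f\|_{\mathrm{BMO}_\rho(\mathcal X)}.$$
   Context: RD-space: $(\mathcal X,d)$ is a metric space with a regular Borel measure $\mu$ such that all balls $B(x,r)=\{y: d(x,y)<r\}$ have finite and positive measure; $\mu$ is doubling, i.e. there is $A_1\ge1$ with $\mu(B(x,2r))\le A_1\mu(B(x,r))$ for all $x\in\mathcal X$, $r>0$; and there are $0<\kappa\le n$, $A_2\in(0,1]$, $A_3\in[1,\infty)$ such that $A_2\lambda^\kappa\mu(B(x,r))\le\mu(B(x,\lambda r))\le A_3\lambda^n\mu(B(x,r))$ for all $x\in\mathcal X$, $0<r\le \mathrm{diam}(\mathcal X)/2$ and $1\le\lambda\le \mathrm{diam}(\mathcal X)/(2r)$. Balls are understood together with their center and radius. Write $V_r(x)=\mu(B(x,r))$ and $V(x,y)=\mu(B(x,d(x,y)))$. Admissible function: $\rho:\mathcal X\to(0,\infty)$ is admissible if there are positive constants $C_0,k_0$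 such that $\frac1{\rho(x)}\le C_0\frac1{\rho(y)}\left(1+\frac{d(x,y)}{\rho(y)}\right)^{k_0}$ for all $x,y\in\mathcal X$. Continuous approximation of the identity of order $(\epsilon_1,\epsilon_2)$: a family $\{S_t\}_{t>0}$ of bounded linear integral operators on $L^2(\mathcal X)$ with measurable kernels $S_t(x,y):\mathcal X\times\mathcal X\to\mathbb C$ (so $S_t(f)(x)=\int_{\mathcal X}S_t(x,y)f(y)\,d\mu(y)$) for which there is a positive constant $A_4$ such that for all $t>0$ and $x,x',y\in\mathcal X$: (i) $|S_t(x,y)|\le A_4\frac1{V_t(x)+V_t(y)+V(x,y)}\frac{t^{\epsilon_2}}{(t+d(x,y))^{\epsilon_2}}$; (ii) $|S_t(x,y)-S_t(x',y)|\le A_4\left(\frac{d(x,x')}{t+d(x,y)}\right)^{\epsilon_1}\frac1{V_t(x)+V_t(y)+V(x,y)}\frac{t^{\epsilon_2}}{(t+d(x,y))^{\epsilon_2}}$ whenever $d(x,x')\le(t+d(x,y))/2$; (iii) property (ii) also holds with the roles of $x$ and $y$ interchanged; (iv) $\int_{\mathcal X}S_t(x,z)\,d\mu(z)=1=\int_{\mathcal X}S_t(z,y)\,d\mu(z)$. $L^1_{\rm loc}(\mathcal X)$ means integrable on every ball; $f_B=\frac1{\mu(B)}\int_B f\,d\mu$. With $\mathcal D$ the collection of balls $B(x,r)$ with $r\ge\rho(x)$, $\mathrm{BMO}_\rho(\mathcal X)$ and $\mathrm{BLO}_\rho(\mathcal X)$ (the latter consisting of real-valued functions) are the sets of $f\in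 L^1_{\rm loc}(\mathcal X)$ for which, respectively, the following are finite: $$\|f\|_{\mathrm{BMO}_\rho(\mathcal X)}=\sup_{B\notin\mathcal D}\frac1{\mu(B)}\int_B|f-f_B|\,d\mu+\sup_{B\in\mathcal D}\frac1{\mu(B)}\int_B|f|\,d\mu,$$ $$\|f\|_{\mathrm{BLO}_\rho(\mathcal X)}=\sup_{B\notin\mathcal D}\frac1{\mu(B)}\int_B\left[f-\operatorname*{ess\,inf}_B f\right]d\mu+\sup_{B\in\mathcal D}\frac1{\mu(B)}\int_B|f|\,d\mu.$$
   Formalization: The admissible function ρ is additionally assumed to be Borel measurable; without this, S^+_ρ(f) can be nonmeasurable (e.g. on the real line with ρ taking the values 1 and 2 on nonmeasurable sets), so it need not belong to L^1_loc. *)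

theory Defs
  imports "HOL-Analysis.Analysis" "HOL-Probability.Essential_Supremum"
begin

section \<open>RD-spaces\<close>

text \<open>The underlying metric space is the universe of a type of class \<^class>\<open>metric_space\<close>.
  Regularity is meant in the sense usual for measures on metric spaces (outer regular with respect
  to open sets, inner regular with respect to closed sets). It is implied by inner regularity
  with respect to compact sets, so no completeness of the space is built in.\<close>

definition regular_borel :: "'a::metric_space measure \<Rightarrow> bool" where
  "regular_borel M \<longleftrightarrow> sets M = sets borel \<and>
     (\<forall>A\<in>sets M. emeasure M A = (INF U\<in>{U. open U \<and> A \<subseteq> U}. emeasure M U) \<and>
                 emeasure M A = (SUP F\<in>{F. closed F \<and> F \<subseteq> A}. emeasure M F))"

text \<open>The library's \<^const>\<open>diameter\<close> is real-valued and meaningless for unbounded sets.\<close>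

definition ediam :: "'a::metric_space itself \<Rightarrow> ereal" where
  "ediam _ = (SUP x::'a. SUP y::'a. ereal (dist x y))"

definition vol :: "'a::metric_space measure \<Rightarrow> real \<Rightarrow> 'a \<Rightarrow> real" where
  "vol M r x = measure M (ball x r)"

definition RD_space :: "'a::metric_space measure \<Rightarrow> bool" where
  "RD_space M \<longleftrightarrow>
     regular_borel M \<and>
     (\<forall>x r. 0 < r \<longrightarrow> 0 < emeasure M (ball x r) \<and> emeasure M (ball x r) < \<infinity>) \<and>
     (\<exists>A1\<ge>1. \<forall>x r. 0 < r \<longrightarrow> vol M (2 * r) x \<le> A1 * vol M r x) \<and>
     (\<exists>\<kappa> n A2 A3. 0 < \<kappa> \<and> \<kappa> \<le> n \<and> 0 < A2 \<and> A2 \<le> 1 \<and> 1 \<le> A3 \<and>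
        (\<forall>x r s. 0 < r \<longrightarrow> ereal r \<le> ediam TYPE('a) / 2 \<longrightarrow>
           1 \<le> s \<longrightarrow> ereal s \<le> ediam TYPE('a) / ereal (2 * r) \<longrightarrow>
           A2 * s powr \<kappa> * vol M r x \<le> vol M (s * r) x \<and>
           vol M (s * r) x \<le> A3 * s powr n * vol M r x))"

section \<open>Admissible functions\<close>

text \<open>Admissibility does not entail measurability (any function with values between 1 and 2 is
  admissible), so measurability of \<open>\<rho>\<close> is a separate hypothesis where it is needed.\<close>

definition admissible :: "('a::metric_space \<Rightarrow> real) \<Rightarrow> bool" where
  "admissible \<rho> \<longleftrightarrow> (\<forall>x. 0 < \<rho> x) \<and>
     (\<exists>C0>0. \<exists>k0>0. \<forall>x y. 1 / \<rho> x \<le> C0 * (1 / \<rho> y) * (1 + dist x y / \<rho> y) powr k0)"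

section \<open>Continuous approximations of the identity\<close>

definition kernel_op :: "'a measure \<Rightarrow> ('a \<Rightarrow> 'a \<Rightarrow> complex) \<Rightarrow> ('a \<Rightarrow> complex) \<Rightarrow> 'a \<Rightarrow> complex" where
  "kernel_op M K f x = (LINT y|M. K x y * f y)"

definition square_integrable :: "'a measure \<Rightarrow> ('a \<Rightarrow> complex) \<Rightarrow> bool" where
  "square_integrable M f \<longleftrightarrow>
     f \<in> borel_measurable M \<and> integrable M (\<lambda>x. (cmod (f x))\<^sup>2)"

text \<open>The integrability clause makes \<^const>\<open>kernel_op\<close> meaningful, since a Bochner
  integral that does not exist is 0 by convention.\<close>

definition bounded_on_L2 :: "'a measure \<Rightarrow> ('a \<Rightarrow> 'a \<Rightarrow> complex) \<Rightarrow> bool" where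
  "bounded_on_L2 M K \<longleftrightarrow>
     (\<exists>c\<ge>0. \<forall>f. square_integrable M f \<longrightarrow>
        (AE x in M. integrable M (\<lambda>y. K x y * f y)) \<and>
        square_integrable M (kernel_op M K f) \<and>
        sqrt (LINT x|M. (cmod (kernel_op M K f x))\<^sup>2) \<le> c * sqrt (LINT x|M. (cmod (f x))\<^sup>2))"

definition cai_bound :: "'a::metric_space measure \<Rightarrow> real \<Rightarrow> real \<Rightarrow> 'a \<Rightarrow> 'a \<Rightarrow> real" where
  "cai_bound M \<epsilon>2 t x y =
     1 / (vol M t x + vol M t y + vol M (dist x y) x) *
     (t powr \<epsilon>2 / (t + dist x y) powr \<epsilon>2)"

text \<open>The family is indexed by all reals, but only its members with \<open>t > 0\<close> matter.\<close>

definition continuous_approx_identity ::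
    "'a::metric_space measure \<Rightarrow> real \<Rightarrow> real \<Rightarrow> (real \<Rightarrow> 'a \<Rightarrow> 'a \<Rightarrow> complex) \<Rightarrow> bool" where
  "continuous_approx_identity M \<epsilon>1 \<epsilon>2 S \<longleftrightarrow>
     (\<forall>t>0. case_prod (S t) \<in> borel_measurable (M \<Otimes>\<^sub>M M) \<and> bounded_on_L2 M (S t)) \<and>
     (\<exists>A4>0. \<forall>t>0.
        (\<forall>x y. cmod (S t x y) \<le> A4 * cai_bound M \<epsilon>2 t x y) \<and>
        (\<forall>x x' y. dist x x' \<le> (t + dist x y) / 2 \<longrightarrow>
           cmod (S t x y - S t x' y)
             \<le> A4 * (dist x x' / (t + dist x y)) powr \<epsilon>1 * cai_bound M \<epsilon>2 t x y) \<and>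
        (\<forall>x y y'. dist y y' \<le> (t + dist x y) / 2 \<longrightarrow>
           cmod (S t x y - S t x y')
             \<le> A4 * (dist y y' / (t + dist x y)) powr \<epsilon>1 * cai_bound M \<epsilon>2 t x y) \<and>
        (\<forall>x. has_bochner_integral M (\<lambda>z. S t x z) 1) \<and>
        (\<forall>y. has_bochner_integral M (\<lambda>z. S t z y) 1))"

text \<open>The supremum may be infinite at some points, hence the extended values.\<close>

definition radial_maximal ::
    "'a measure \<Rightarrow> (real \<Rightarrow> 'a \<Rightarrow> 'a \<Rightarrow> complex) \<Rightarrow> ('a \<Rightarrow> real) \<Rightarrow> ('a \<Rightarrow> complex) \<Rightarrow> 'a \<Rightarrow> ennreal" where
  "radial_maximal M S \<rho> f x = (SUP t\<in>{0<..<\<rho> x}. ennreal (cmod (kernel_op M (S t) f x)))"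

section \<open>Localized BMO and BLO\<close>

definition L1_loc ::
    "'a::metric_space measure \<Rightarrow> ('a \<Rightarrow> 'b::{banach, second_countable_topology}) set" where
  "L1_loc M = {f. \<forall>x. \<forall>r>0. set_integrable M (ball x r) f}"

definition set_mean :: "'a measure \<Rightarrow> 'a set \<Rightarrow> ('a \<Rightarrow> complex) \<Rightarrow> complex" where
  "set_mean M B f = (LINT y:B|M. f y) /\<^sub>R measure M B"

definition nn_set_mean :: "'a measure \<Rightarrow> 'a set \<Rightarrow> ('a \<Rightarrow> ennreal) \<Rightarrow> ennreal" where
  "nn_set_mean M B g = (\<integral>\<^sup>+y\<in>B. g y \<partial>M) / emeasure M B"

definition essinf_on :: "'a measure \<Rightarrow> 'a set \<Rightarrow> ('a \<Rightarrow> real) \<Rightarrow> ereal" where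
  "essinf_on M B f = - esssup (restrict_space M B) (\<lambda>y. - ereal (f y))"

text \<open>Balls are pairs \<open>(x, r)\<close> of a center and a radius.\<close>

definition large_balls :: "('a \<Rightarrow> real) \<Rightarrow> ('a \<times> real) set" where
  "large_balls \<rho> = {(x, r). 0 < r \<and> \<rho> x \<le> r}"

definition small_balls :: "('a \<Rightarrow> real) \<Rightarrow> ('a \<times> real) set" where
  "small_balls \<rho> = {(x, r). 0 < r \<and> \<not> \<rho> x \<le> r}"

definition bmo_norm :: "'a::metric_space measure \<Rightarrow> ('a \<Rightarrow> real) \<Rightarrow> ('a \<Rightarrow> complex) \<Rightarrow> ennreal" where
  "bmo_norm M \<rho> f =
     (SUP (x, r)\<in>small_balls \<rho>.
        nn_set_mean M (ball x r) (\<lambda>y. ennreal (cmod (f y - set_mean M (ball x r) f)))) +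
     (SUP (x, r)\<in>large_balls \<rho>.
        nn_set_mean M (ball x r) (\<lambda>y. ennreal (cmod (f y))))"

text \<open>The difference \<open>f y - ess inf\<close> is nonnegative almost everywhere on the ball, so the
  truncation performed by \<^const>\<open>e2ennreal\<close> is harmless; if the essential infimum is
  \<open>-\<infinity>\<close>, the mean is \<open>\<infinity>\<close>.\<close>

definition blo_norm :: "'a::metric_space measure \<Rightarrow> ('a \<Rightarrow> real) \<Rightarrow> ('a \<Rightarrow> real) \<Rightarrow> ennreal" where
  "blo_norm M \<rho> f =
     (SUP (x, r)\<in>small_balls \<rho>.
        nn_set_mean M (ball x r) (\<lambda>y. e2ennreal (ereal (f y) - essinf_on M (ball x r) f))) +
     (SUP (x, r)\<in>large_balls \<rho>.
        nn_set_mean M (ball x r) (\<lambda>y. ennreal \<bar>f y\<bar>))"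

definition BMO :: "'a::metric_space measure \<Rightarrow> ('a \<Rightarrow> real) \<Rightarrow> ('a \<Rightarrow> complex) set" where
  "BMO M \<rho> = {f \<in> L1_loc M. bmo_norm M \<rho> f < \<infinity>}"

definition BLO :: "'a::metric_space measure \<Rightarrow> ('a \<Rightarrow> real) \<Rightarrow> ('a \<Rightarrow> real) set" where
  "BLO M \<rho> = {f \<in> L1_loc M. blo_norm M \<rho> f < \<infinity>}"

end

theory Submission
  imports Defs
begin

text \<open>Write \<open>N\<close> for a bound on the mean oscillation of \<open>f\<close> over all balls. Since the kernels have integral 1,
  decay geometrically over dyadic shells, and live on a doubling space, \<open>S\<^sub>t f x\<close> differs from the mean of \<open>f\<close>
  over \<open>B(x,t)\<close> by at most a multiple of \<open>N\<close>. Consequently the values \<open>S\<^sub>t f x\<close> and \<open>S\<^sub>s f y\<close> agree up to a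
  multiple of \<open>N\<close> whenever \<open>t\<close> and \<open>s\<close> are comparable and the distance of \<open>x\<close> and \<open>y\<close> is at most a multiple
  of them (\<open>T_comparable_avg\<close>).

  The analytic core is \<open>local_max_mean\<close>: for each ball \<open>B\<close> of radius \<open>r\<close>, the mean over \<open>B\<close> of the supremum over
  \<open>t \<le> r\<close> of \<open>\<bar>S\<^sub>t f - f\<^sub>B\<bar>\<close> is at most a multiple of \<open>N\<close>. It replaces both the John--Nirenberg
  inequality and the maximal theorem. If \<open>\<phi>\<close> bounds these means over all balls, a stopping time argument with a
  Vitali selection shows that a multiple of \<open>N\<close> plus \<open>\<phi> / 2\<close> bounds them too (\<open>stopping_time_step\<close>). Truncating
  the supremum provides a finite \<open>\<phi>\<close> to start from, and iteration makes the initial value disappear.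

  The theorem follows by comparing radii with \<open>\<rho>\<close>, which by admissibility varies by a bounded factor at distances up
  to \<open>\<rho>\<close>. On a ball of radius \<open>r \<ge> \<rho> x\<close>, only radii below a multiple of \<open>r\<close> occur in the radial maximal
  function; it is controlled by the local maximal function of a dilated ball and by the mean of \<open>f\<close>, which is
  bounded for large balls (\<open>radial_mean_large\<close>). On a small ball, the value of the radial maximal function at any point
  exceeds its value at any other point by at most a multiple of \<open>N\<close> plus the local maximal function
  (\<open>radial_le_local_max\<close>), and this one-sided comparison is what the BLO norm measures. Measurability comes
  from the continuity of \<open>S\<^sub>t f\<close>, which makes suprema over arbitrary sets of radii lower semicontinuous.\<close>

section \<open>The Vitali selection of balls\<close>

text \<open>Greedy choice, made by Zorn's lemma on the disjoint subfamilies satisfying the invariant that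
  a ball meeting some chosen ball also meets a chosen ball of at least half its radius. A maximal
  such subfamily meets every ball: otherwise a ball whose radius exceeds half the supremum of the
  radii of the balls left over could be added. Only the centres have to be covered, so the dilation
  factor 3 would do; 4 is two doublings.\<close>

lemma vitali_selection:
  fixes E :: "'a::metric_space set" and t :: "'a \<Rightarrow> real"
  assumes t: "\<And>x. x \<in> E \<Longrightarrow> 0 < t x \<and> t x \<le> R"
  obtains C where "C \<subseteq> E" "disjoint_family_on (\<lambda>c. ball c (t c)) C"
    "E \<subseteq> (\<Union>c\<in>C. ball c (4 * t c))"
proof -
  define meets where "meets x y \<longleftrightarrow> ball x (t x) \<inter> ball y (t y) \<noteq> {}" for x y
  define admiss where "admiss C \<longleftrightarrow> C \<subseteq> E \<and> disjoint_family_on (\<lambda>c. ball c (t c)) C \<and>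
      (\<forall>x\<in>E. (\<exists>c\<in>C. meets x c) \<longrightarrow> (\<exists>c\<in>C. meets x c \<and> t x \<le> 2 * t c))" for C
  have "\<exists>C\<in>Collect admiss. \<forall>X\<in>Collect admiss. C \<subseteq> X \<longrightarrow> X = C"
  proof (rule Zorn_Lemma, rule ballI)
    fix K assume K: "K \<in> chains (Collect admiss)"
    then have adm: "\<And>C. C \<in> K \<Longrightarrow> admiss C" by (auto dest: chainsD2)
    have "disjoint_family_on (\<lambda>c. ball c (t c)) (\<Union>K)"
      unfolding disjoint_family_on_def
    proof (intro ballI impI)
      fix a b assume "a \<in> \<Union>K" "b \<in> \<Union>K" "a \<noteq> b"
      then obtain C where "C \<in> K" "a \<in> C" "b \<in> C" using chainsD[OF K] by blast
      with adm[of C] \<open>a \<noteq> b\<close> show "ball a (t a) \<inter> ball b (t b) = {}"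
        unfolding admiss_def disjoint_family_on_def by blast
    qed
    moreover have "\<exists>c\<in>\<Union>K. meets x c \<and> t x \<le> 2 * t c" if "x \<in> E" "c \<in> \<Union>K" "meets x c" for x c
      using adm that unfolding admiss_def by blast
    ultimately show "\<Union>K \<in> Collect admiss"
      using adm unfolding admiss_def by blast
  qed
  then obtain C where C: "admiss C" and max: "\<And>X. admiss X \<Longrightarrow> C \<subseteq> X \<Longrightarrow> X = C" by blast
  have all: "\<exists>c\<in>C. meets x c" if "x \<in> E" for x
  proof (rule ccontr)
    assume neg: "\<not> (\<exists>c\<in>C. meets x c)"
    define F where "F = {x\<in>E. \<not> (\<exists>c\<in>C. meets x c)}"
    have "x \<in> F" using that neg by (auto simp: F_def)
    have bdd: "bdd_above (t ` F)" using t by (auto simp: F_def bdd_above_def)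
    have "t x \<le> Sup (t ` F)" using \<open>x \<in> F\<close> bdd by (auto intro: cSup_upper)
    then have "Sup (t ` F) / 2 < Sup (t ` F)" using t[OF that] by simp
    then have "\<exists>s\<in>t ` F. Sup (t ` F) / 2 < s"
      using less_cSup_iff[of "t ` F" "Sup (t ` F) / 2"] bdd \<open>x \<in> F\<close> by blast
    then obtain y where y: "y \<in> F" "Sup (t ` F) / 2 < t y" by blast
    have big: "t z \<le> 2 * t y" if "z \<in> F" for z
      using cSup_upper[OF imageI[OF that] bdd] y(2) by simp
    have "admiss (insert y C)"
      unfolding admiss_def
    proof (intro conjI ballI impI)
      show "insert y C \<subseteq> E" using C y by (auto simp: admiss_def F_def)
      show "disjoint_family_on (\<lambda>c. ball c (t c)) (insert y C)"
        using C y by (auto simp: admiss_def F_def meets_def disjoint_family_on_def)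
      fix z assume z: "z \<in> E" "\<exists>c\<in>insert y C. meets z c"
      show "\<exists>c\<in>insert y C. meets z c \<and> t z \<le> 2 * t c"
      proof (cases "z \<in> F")
        case True then show ?thesis using z big by (auto simp: F_def)
      next
        case False then show ?thesis using z C by (auto simp: F_def admiss_def)
      qed
    qed
    then have "y \<in> C" using max by blast
    moreover have "meets y y" using t[of y] y by (force simp: meets_def F_def)
    ultimately show False using y by (auto simp: F_def)
  qed
  show ?thesis
  proof
    show "C \<subseteq> E" "disjoint_family_on (\<lambda>c. ball c (t c)) C" using C by (auto simp: admiss_def)
    show "E \<subseteq> (\<Union>c\<in>C. ball c (4 * t c))"
    proof
      fix x assume "x \<in> E"
      with all C obtain c where c: "c \<in> C" "meets x c" "t x \<le> 2 * t c" by (auto simp: admiss_def)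
      then obtain z where "dist x z < t x" "dist c z < t c" by (auto simp: meets_def)
      then have "dist c x < 4 * t c"
        using dist_triangle2[of c x z] c(3) zero_le_dist[of c z] by linarith
      with c show "x \<in> (\<Union>c\<in>C. ball c (4 * t c))" by auto
    qed
  qed
qed

lemma countable_disjoint_positive_measure:
  assumes disj: "disjoint_family_on X I" and sub: "\<And>i. i \<in> I \<Longrightarrow> X i \<subseteq> B"
    and meas: "\<And>i. i \<in> I \<Longrightarrow> X i \<in> sets M" "B \<in> sets M"
    and pos: "\<And>i. i \<in> I \<Longrightarrow> 0 < measure M (X i)" and fin: "emeasure M B < \<infinity>"
  shows "countable I"
proof -
  have B: "B \<in> fmeasurable M" using meas fin by (simp add: fmeasurable_def)
  have "(\<lambda>i. measure M (X i)) summable_on I"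
  proof (rule nonneg_bdd_above_summable_on)
    \<comment> \<open>The total measure of finitely many members is at most that of the set containing them all.\<close>
    show "bdd_above (sum (\<lambda>i. measure M (X i)) ` {F. F \<subseteq> I \<and> finite F})"
    proof (rule bdd_aboveI2)
      fix F assume "F \<in> {F. F \<subseteq> I \<and> finite F}"
      then have F: "F \<subseteq> I" "finite F" by auto
      have Xi: "X i \<in> fmeasurable M" if "i \<in> F" for i
        using fmeasurableI2[OF B] sub meas F that by blast
      have "(\<Sum>i\<in>F. measure M (X i)) = measure M (\<Union>i\<in>F. X i)"
        using F disj Xi
        by (intro measure_finite_Union[symmetric])
          (auto simp: fmeasurable_def top_unique less_top disjoint_family_on_def)
      also have "\<dots> \<le> measure M B"
        using F sub meas B by (intro measure_mono_fmeasurable sets.finite_UN) auto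
      finally show "(\<Sum>i\<in>F. measure M (X i)) \<le> measure M B" .
    qed
  qed auto
  then have "countable {i\<in>I. measure M (X i) \<noteq> 0}"
    by (rule summable_countable_real)
  also have "{i\<in>I. measure M (X i) \<noteq> 0} = I" using pos by fastforce
  finally show ?thesis .
qed

section \<open>Means over balls of a doubling measure\<close>

locale doubling_measure =
  fixes M :: "'a::metric_space measure" and A :: real
  assumes sets_M: "sets M = sets borel"
    and ball_pos: "0 < r \<Longrightarrow> 0 < emeasure M (ball x r)"
    and ball_fin: "0 < r \<Longrightarrow> emeasure M (ball x r) < \<infinity>"
    and one_le_A: "1 \<le> A"
    and doubling: "0 < r \<Longrightarrow> vol M (2 * r) x \<le> A * vol M r x"
begin

abbreviation avg :: "('a \<Rightarrow> complex) \<Rightarrow> 'a \<Rightarrow> real \<Rightarrow> complex" where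
  "avg f x r \<equiv> set_mean M (ball x r) f"

lemma space_M [simp]: "space M = UNIV"
  using sets_eq_imp_space_eq[OF sets_M] by simp

lemma ball_sets [measurable, simp]: "ball x r \<in> sets M"
  by (simp add: sets_M)

lemma vol_pos: "0 < r \<Longrightarrow> 0 < vol M r x"
  using ball_pos[of r x] ball_fin[of r x] by (simp add: vol_def measure_def enn2real_positive_iff)

lemma vol_nonneg [simp]: "0 \<le> vol M r x"
  by (simp add: vol_def)

lemma emeasure_ball: "0 < r \<Longrightarrow> emeasure M (ball x r) = ennreal (vol M r x)"
  using ball_fin[of r x] by (simp add: vol_def emeasure_eq_ennreal_measure less_top)

lemma vol_mono: "ball x r \<subseteq> ball y s \<Longrightarrow> 0 < s \<Longrightarrow> vol M r x \<le> vol M s y"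
  unfolding vol_def using ball_fin[of s y]
  by (intro measure_mono_fmeasurable) (auto simp: fmeasurable_def)

lemma vol_le: "dist y x + r \<le> s \<Longrightarrow> 0 < s \<Longrightarrow> vol M r x \<le> vol M s y"
  using dist_triangle[of y _ x] by (intro vol_mono subsetI) (smt (verit) mem_ball)+

lemma vol_power: "0 < r \<Longrightarrow> vol M (2 ^ k * r) x \<le> A ^ k * vol M r x"
proof (induction k)
  case (Suc k)
  have "vol M (2 ^ Suc k * r) x \<le> A * vol M (2 ^ k * r) x"
    using doubling[of "2 ^ k * r" x] Suc.prems by (simp add: mult.assoc)
  also have "\<dots> \<le> A * (A ^ k * vol M r x)"
    using Suc one_le_A by (intro mult_left_mono) auto
  finally show ?case by (simp add: mult.assoc)
qed simp

lemma vol_dilate: "\<exists>K\<ge>1. \<forall>x r. 0 < r \<longrightarrow> vol M (\<Lambda> * r) x \<le> K * vol M r x"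
proof -
  obtain k where k: "\<Lambda> < 2 ^ k" using real_arch_pow[of 2 \<Lambda>] by auto
  have "vol M (\<Lambda> * r) x \<le> A ^ k * vol M r x" if "0 < r" for x r
  proof -
    have "vol M (\<Lambda> * r) x \<le> vol M (2 ^ k * r) x"
      using k that by (intro vol_le) auto
    also have "\<dots> \<le> A ^ k * vol M r x" by (rule vol_power[OF that])
    finally show ?thesis .
  qed
  then show ?thesis using one_le_power[OF one_le_A, of k] by blast
qed

lemma L1_loc_measurable:
  assumes "f \<in> L1_loc M" shows "f \<in> borel_measurable M"
proof -
  fix z :: 'a
  have m: "(\<lambda>y. indicator (ball z (real (Suc k))) y *\<^sub>R f y) \<in> borel_measurable M" for k
    using assms unfolding L1_loc_def set_integrable_def by (auto intro: borel_measurable_integrable)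
  show ?thesis
  proof (rule borel_measurable_LIMSEQ_metric[OF m])
    fix y
    obtain k0 where "dist z y < real k0" using reals_Archimedean2 by blast
    then have "eventually (\<lambda>k. dist z y < real (Suc k)) sequentially"
      unfolding eventually_sequentially by (intro exI[of _ k0]) auto
    then show "(\<lambda>k. indicator (ball z (real (Suc k))) y *\<^sub>R f y) \<longlonglongrightarrow> f y"
      by (intro tendsto_eventually) (auto elim!: eventually_mono)
  qed
qed

text \<open>This lemma is also applied in contrapositive form: a mean far from \<open>c\<close> forces a large integral of
  \<open>\<bar>f - c\<bar>\<close>, the lower bound that a stopping radius provides.\<close>

lemma avg_close:
  assumes f: "f \<in> L1_loc M" and r: "0 < r" and sub: "ball x r \<subseteq> B" and H: "0 \<le> H"
    and bound: "(\<integral>\<^sup>+y\<in>B. ennreal (cmod (f y - c)) \<partial>M) \<le> ennreal (H * vol M r x)"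
  shows "cmod (avg f x r - c) \<le> H"
proof -
  let ?B = "ball x r"
  have intf: "set_integrable M ?B f" using f r by (auto simp: L1_loc_def)
  have intc: "set_integrable M ?B (\<lambda>_. c)"
    unfolding set_integrable_def using ball_fin[OF r, of x] by simp
  have "(LINT y:?B|M. c) = vol M r x *\<^sub>R c"
    using ball_fin[OF r, of x] by (simp add: set_lebesgue_integral_def vol_def)
  then have eq: "(LINT y:?B|M. f y - c) = vol M r x *\<^sub>R (avg f x r - c)"
    using set_integral_diff(2)[OF intf intc] vol_pos[OF r, of x]
    by (simp add: set_mean_def scaleR_diff_right flip: vol_def)
  have "ennreal (vol M r x * cmod (avg f x r - c)) = ennreal (cmod (LINT y:?B|M. f y - c))"
    by (simp add: eq)
  also have "\<dots> \<le> (\<integral>\<^sup>+y. ennreal (cmod (indicator ?B y *\<^sub>R (f y - c))) \<partial>M)"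
    using set_integral_diff(1)[OF intf intc]
    unfolding set_lebesgue_integral_def set_integrable_def
    by (intro integral_norm_bound_ennreal)
  also have "\<dots> \<le> (\<integral>\<^sup>+y\<in>B. ennreal (cmod (f y - c)) \<partial>M)"
    using sub by (intro nn_integral_mono) (auto simp: indicator_def)
  also note bound
  finally have "vol M r x * cmod (avg f x r - c) \<le> H * vol M r x"
    using H by (simp add: ennreal_le_iff)
  then show ?thesis using vol_pos[OF r, of x] by (simp add: mult.commute)
qed

text \<open>Membership in BMO with norm at most \<open>N\<close>. The bound is strictly positive because multiples of
  \<open>N\<close> serve as stopping heights and appear in denominators; for a function of norm 0 every
  \<open>N > 0\<close> is a bound.\<close>

definition osc_bound :: "('a \<Rightarrow> complex) \<Rightarrow> real \<Rightarrow> bool" where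
  "osc_bound f N \<longleftrightarrow> f \<in> L1_loc M \<and> 0 < N \<and>
     (\<forall>x r. 0 < r \<longrightarrow>
        (\<integral>\<^sup>+y\<in>ball x r. ennreal (cmod (f y - avg f x r)) \<partial>M) \<le> ennreal (N * vol M r x))"

lemma nn_integral_shift_constant:
  assumes f: "f \<in> L1_loc M" and r: "0 < r" and H: "0 \<le> H"
    and bound: "(\<integral>\<^sup>+y\<in>ball x r. ennreal (cmod (f y - b)) \<partial>M) \<le> ennreal (H * vol M r x)"
  shows "(\<integral>\<^sup>+y\<in>ball x r. ennreal (cmod (f y - c)) \<partial>M) \<le> ennreal ((H + cmod (b - c)) * vol M r x)"
proof -
  have [measurable]: "f \<in> borel_measurable M" using f by (rule L1_loc_measurable)
  let ?d = "cmod (b - c)"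
  have "ennreal (cmod (f y - c)) * indicator (ball x r) y
     \<le> ennreal (cmod (f y - b)) * indicator (ball x r) y + ennreal ?d * indicator (ball x r) y" for y
    using norm_triangle_ineq[of "f y - b" "b - c"]
    by (auto simp: indicator_def ennreal_plus[symmetric] intro!: ennreal_leI simp del: ennreal_plus)
  then have "(\<integral>\<^sup>+y\<in>ball x r. ennreal (cmod (f y - c)) \<partial>M) \<le>
      (\<integral>\<^sup>+y. ennreal (cmod (f y - b)) * indicator (ball x r) y + ennreal ?d * indicator (ball x r) y \<partial>M)"
    by (intro nn_integral_mono)
  also have "\<dots> = (\<integral>\<^sup>+y\<in>ball x r. ennreal (cmod (f y - b)) \<partial>M) + ennreal ?d * emeasure M (ball x r)"
    by (subst nn_integral_add) (auto simp: nn_integral_cmult_indicator)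
  also have "\<dots> \<le> ennreal (H * vol M r x) + ennreal ?d * ennreal (vol M r x)"
    using r by (intro add_mono bound) (simp add: emeasure_ball)
  also have "\<dots> = ennreal ((H + ?d) * vol M r x)"
    using H by (simp add: ennreal_mult[symmetric] ennreal_plus[symmetric] distrib_right del: ennreal_plus)
  finally show ?thesis .
qed

lemma osc_around:
  assumes f: "osc_bound f N" and r: "0 < r"
  shows "(\<integral>\<^sup>+y\<in>ball x r. ennreal (cmod (f y - c)) \<partial>M)
    \<le> ennreal ((N + cmod (avg f x r - c)) * vol M r x)"
  using f r by (intro nn_integral_shift_constant) (auto simp: osc_bound_def)

lemma avg_sub_ball:
  assumes f: "osc_bound f N" and "0 < r" "0 < s" "ball x r \<subseteq> ball y s" "0 \<le> K"
    and "vol M s y \<le> K * vol M r x"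
  shows "cmod (avg f x r - avg f y s) \<le> K * N"
proof (rule avg_close[where B = "ball y s"])
  have N: "0 < N" using f by (simp add: osc_bound_def)
  have "(\<integral>\<^sup>+z\<in>ball y s. ennreal (cmod (f z - avg f y s)) \<partial>M) \<le> ennreal (N * vol M s y)"
    using f assms by (simp add: osc_bound_def)
  also have "\<dots> \<le> ennreal (K * N * vol M r x)"
    using assms N mult_left_mono[of "vol M s y" "K * vol M r x" N] by (auto intro!: ennreal_leI simp: ac_simps)
  finally show "(\<integral>\<^sup>+z\<in>ball y s. ennreal (cmod (f z - avg f y s)) \<partial>M) \<le> ennreal (K * N * vol M r x)" .
  show "f \<in> L1_loc M" "0 < r" "ball x r \<subseteq> ball y s" "0 \<le> K * N"
    using assms N by (simp_all add: osc_bound_def)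
qed

text \<open>Both balls lie in \<open>B(x, 2\<Lambda>r)\<close>, whose measure is controlled by that of either ball, so both means
  are close to the mean over this larger ball.\<close>

lemma avg_comparable:
  assumes "1 \<le> \<Lambda>"
  shows "\<exists>K>0. \<forall>f N x y r s. osc_bound f N \<longrightarrow> 0 < r \<longrightarrow> 0 < s \<longrightarrow>
     dist x y \<le> \<Lambda> * r \<longrightarrow> s \<le> \<Lambda> * r \<longrightarrow> r \<le> \<Lambda> * s \<longrightarrow>
     cmod (avg f x r - avg f y s) \<le> K * N"
proof -
  obtain K1 where K1: "1 \<le> K1" "\<And>x r. 0 < r \<Longrightarrow> vol M (2 * \<Lambda> * r) x \<le> K1 * vol M r x"
    using vol_dilate by blast
  obtain K2 where K2: "1 \<le> K2" "\<And>x r. 0 < r \<Longrightarrow> vol M (3 * \<Lambda> * \<Lambda> * r) x \<le> K2 * vol M r x"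
    using vol_dilate by blast
  have "cmod (avg f x r - avg f y s) \<le> (K1 + K2) * N"
    if f: "osc_bound f N" and rs: "0 < r" "0 < s" "dist x y \<le> \<Lambda> * r" "s \<le> \<Lambda> * r" "r \<le> \<Lambda> * s"
    for f N x y r s
  proof -
    have Lr: "r \<le> \<Lambda> * r" "0 < \<Lambda> * r" using assms rs by auto
    \<comment> \<open>Hence \<open>B(x, 2\<Lambda>r)\<close> is contained in \<open>B(y, 3\<Lambda>\<^sup>2s)\<close>, a fixed dilate of the second ball.\<close>
    have LL: "\<Lambda> * r \<le> \<Lambda> * \<Lambda> * s" using mult_left_mono[OF rs(5), of \<Lambda>] assms by (simp add: mult.assoc)
    have "cmod (avg f x r - avg f x (2 * \<Lambda> * r)) \<le> K1 * N"
    proof (rule avg_sub_ball[OF f])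
      show "ball x r \<subseteq> ball x (2 * \<Lambda> * r)" using Lr by (intro subset_ball) linarith
      show "vol M (2 * \<Lambda> * r) x \<le> K1 * vol M r x" by (rule K1(2)[OF rs(1)])
      show "0 < 2 * \<Lambda> * r" "0 \<le> K1" using Lr K1(1) by linarith+
    qed (rule rs(1))
    moreover have "cmod (avg f y s - avg f x (2 * \<Lambda> * r)) \<le> K2 * N"
    proof (rule avg_sub_ball[OF f])
      show "ball y s \<subseteq> ball x (2 * \<Lambda> * r)"
      proof
        fix z assume "z \<in> ball y s"
        then show "z \<in> ball x (2 * \<Lambda> * r)" using dist_triangle[of x z y] rs unfolding mem_ball by linarith
      qed
      have "vol M (2 * \<Lambda> * r) x \<le> vol M (3 * \<Lambda> * \<Lambda> * s) y"
      proof (rule vol_le)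
        show "dist y x + 2 * \<Lambda> * r \<le> 3 * \<Lambda> * \<Lambda> * s" "0 < 3 * \<Lambda> * \<Lambda> * s"
          using rs(3) Lr LL dist_commute[of x y] by linarith+
      qed
      also have "\<dots> \<le> K2 * vol M s y" by (rule K2(2)[OF rs(2)])
      finally show "vol M (2 * \<Lambda> * r) x \<le> K2 * vol M s y" .
      show "0 < s" "0 < 2 * \<Lambda> * r" "0 \<le> K2" using Lr K2(1) rs(2) by linarith+
    qed
    moreover have "cmod (avg f x r - avg f y s) \<le> cmod (avg f x r - avg f x (2 * \<Lambda> * r))
        + cmod (avg f y s - avg f x (2 * \<Lambda> * r))"
      using dist_triangle2[of "avg f x r" "avg f y s" "avg f x (2 * \<Lambda> * r)"] by (simp add: dist_norm)
    ultimately show ?thesis by (simp add: distrib_right)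
  qed
  moreover have "0 < K1 + K2" using K1(1) K2(1) by linarith
  ultimately show ?thesis by blast
qed

end

section \<open>Kernel operators on functions of bounded mean oscillation\<close>

lemma geometric_linear_sums:
  fixes q :: real
  assumes "0 < q" "q < 1"
  shows "\<exists>s>0. (\<lambda>k. real (k + 1) * q ^ k) sums s"
proof -
  have "(\<lambda>k. of_nat (Suc k) * q ^ k) sums (1 / (1 - q)\<^sup>2)"
    using geometric_deriv_sums[of q] assms by simp
  then show ?thesis using assms by (intro exI[of _ "1 / (1 - q)\<^sup>2"]) auto
qed

context doubling_measure begin

text \<open>The weight is the size of the kernel bound on the shell between \<open>B(x, 2^(k-1) t)\<close> and
  \<open>B(x, 2^k t)\<close>: one doubling to pass from the smaller ball to the larger one, and the decay
  \<open>2^(-(k-1)\<epsilon>)\<close> of the second factor of the bound.\<close>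

definition shell_weight :: "real \<Rightarrow> real \<Rightarrow> 'a \<Rightarrow> nat \<Rightarrow> real" where
  "shell_weight \<epsilon> t x k = A * 2 powr \<epsilon> * (2 powr - \<epsilon>) ^ k / vol M (2 ^ k * t) x"

text \<open>The kernel bound depends on \<open>y\<close> through the volumes of balls around \<open>y\<close>, whose measurability
  is not immediate. A series of indicators of balls is measurable at once and can be integrated
  term by term.\<close>

definition shell_majorant :: "real \<Rightarrow> real \<Rightarrow> 'a \<Rightarrow> 'a \<Rightarrow> ennreal" where
  "shell_majorant \<epsilon> t x y =
     (\<Sum>k. ennreal (shell_weight \<epsilon> t x k) * indicator (ball x (2 ^ k * t)) y)"

lemma shell_majorant_measurable [measurable]: "shell_majorant \<epsilon> t x \<in> borel_measurable M"
  unfolding shell_majorant_def[abs_def] by measurable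

lemma shell_weight_nonneg: "0 \<le> shell_weight \<epsilon> t x k"
  using one_le_A by (simp add: shell_weight_def)

text \<open>Take the least \<open>k\<close> with \<open>y\<close> in \<open>B(x, 2^k t)\<close>. If \<open>k = 0\<close>, the term \<open>V\<^sub>t(x)\<close> of the denominator
  suffices; otherwise \<open>d(x,y)\<close> is at least \<open>2^(k-1) t\<close>, and the term \<open>V(x,y)\<close> is used.\<close>

lemma cai_bound_le_shell_weight:
  assumes "0 < t" "0 < \<epsilon>"
  shows "\<exists>k. y \<in> ball x (2 ^ k * t) \<and> cai_bound M \<epsilon> t x y \<le> shell_weight \<epsilon> t x k"
proof -
  obtain j where "dist x y / t < 2 ^ j" using real_arch_pow[of 2 "dist x y / t"] by auto
  then have ex: "\<exists>k. dist x y < 2 ^ k * t" using assms by (auto simp: divide_less_eq)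
  define k where "k = (LEAST k. dist x y < 2 ^ k * t)"
  have k: "dist x y < 2 ^ k * t" unfolding k_def by (rule LeastI_ex[OF ex])
  define d where "d = dist x y"
  have d: "0 \<le> d" by (simp add: d_def)
  have ratio: "t powr \<epsilon> / (t + d) powr \<epsilon> = (t / (t + d)) powr \<epsilon>"
    using assms d by (simp add: powr_divide)
  have vt: "0 < vol M t z" for z using vol_pos assms by blast
  have "cai_bound M \<epsilon> t x y \<le> shell_weight \<epsilon> t x k"
  proof (cases k)
    case 0
    have "cai_bound M \<epsilon> t x y \<le> 1 / vol M t x * 1"
      unfolding cai_bound_def d_def[symmetric] ratio
    proof (rule mult_mono)
      show "1 / (vol M t x + vol M t y + vol M d x) \<le> 1 / vol M t x"
        using vt[of x] by (intro divide_left_mono) (auto intro!: mult_pos_pos add_pos_nonneg)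
      show "(t / (t + d)) powr \<epsilon> \<le> 1"
        using assms d by (intro powr_le1) auto
    qed (use vt in auto)
    also have "\<dots> \<le> A * 2 powr \<epsilon> / vol M t x"
    proof -
      have "1 \<le> (2::real) powr \<epsilon>" using assms by (simp add: ge_one_powr_ge_zero)
      then have "1 \<le> A * 2 powr \<epsilon>" using one_le_A by (metis mult_mono' mult_1 zero_le_one)
      then show ?thesis using vt[of x] by (simp add: divide_right_mono)
    qed
    finally show ?thesis by (simp add: shell_weight_def 0)
  next
    case (Suc j)
    have "\<not> dist x y < 2 ^ j * t" using not_less_Least[of j "\<lambda>k. dist x y < 2 ^ k * t"] Suc by (simp add: k_def)
    then have j: "2 ^ j * t \<le> d" by (simp add: d_def)
    have jt: "0 < 2 ^ j * t" using assms by simp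
    have vk: "0 < vol M (2 ^ k * t) x" using vol_pos assms by simp
    have V: "vol M (2 ^ k * t) x \<le> A * vol M d x"
    proof -
      have "vol M (2 ^ k * t) x \<le> A * vol M (2 ^ j * t) x"
        using doubling[OF jt, of x] Suc by (simp add: mult.assoc)
      also have "\<dots> \<le> A * vol M d x"
        using j jt one_le_A by (intro mult_left_mono vol_le) auto
      finally show ?thesis .
    qed
    have "cai_bound M \<epsilon> t x y \<le> A / vol M (2 ^ k * t) x * (1 / 2 ^ j) powr \<epsilon>"
      unfolding cai_bound_def d_def[symmetric] ratio
    proof (rule mult_mono)
      have "0 < vol M d x" using j jt by (intro vol_pos) linarith
      then have "1 / (vol M t x + vol M t y + vol M d x) \<le> 1 / vol M d x"
        by (intro divide_left_mono) (auto intro!: mult_pos_pos add_nonneg_pos)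
      also have "\<dots> \<le> A / vol M (2 ^ k * t) x"
        using V vk \<open>0 < vol M d x\<close> by (simp add: field_simps)
      finally show "1 / (vol M t x + vol M t y + vol M d x) \<le> A / vol M (2 ^ k * t) x" .
      have "t / (t + d) \<le> 1 / 2 ^ j" using j assms d by (simp add: field_simps)
      then show "(t / (t + d)) powr \<epsilon> \<le> (1 / 2 ^ j) powr \<epsilon>"
        using assms d by (intro powr_mono2) auto
    qed (use vk one_le_A in auto)
    also have "(1 / 2 ^ j) powr \<epsilon> = 2 powr \<epsilon> * (2 powr - \<epsilon>) ^ k"
      by (simp add: Suc powr_realpow[symmetric] powr_minus_divide powr_divide powr_powr mult.commute
          powr_power power_divide)
    finally show ?thesis by (simp add: shell_weight_def)
  qed
  then show ?thesis using k by auto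
qed

lemma cai_bound_le_shell_majorant:
  assumes "0 < t" "0 < \<epsilon>"
  shows "ennreal (cai_bound M \<epsilon> t x y) \<le> shell_majorant \<epsilon> t x y"
proof -
  obtain k where k: "y \<in> ball x (2 ^ k * t)" "cai_bound M \<epsilon> t x y \<le> shell_weight \<epsilon> t x k"
    using cai_bound_le_shell_weight[OF assms] by blast
  let ?f = "\<lambda>k. ennreal (shell_weight \<epsilon> t x k) * indicator (ball x (2 ^ k * t)) y"
  have "ennreal (cai_bound M \<epsilon> t x y) \<le> sum ?f {k}"
    using k by (simp add: ennreal_leI)
  also have "\<dots> \<le> suminf ?f" by (intro sum_le_suminf) auto
  finally show ?thesis by (simp add: shell_majorant_def)
qed

text \<open>The factor \<open>k + 1\<close> is the rate at which the mean over \<open>B(x, 2^k t)\<close> of the deviation of a BMO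
  function from its mean over \<open>B(x, t)\<close> may grow; the geometric decay of the weights absorbs it.\<close>

lemma shell_majorant_integral:
  assumes "0 < \<epsilon>"
  shows "\<exists>C>0. \<forall>x t h H. 0 < t \<longrightarrow> 0 \<le> H \<longrightarrow> h \<in> borel_measurable M \<longrightarrow>
     (\<forall>k. (\<integral>\<^sup>+y\<in>ball x (2 ^ k * t). h y \<partial>M) \<le> ennreal (real (k + 1) * H * vol M (2 ^ k * t) x)) \<longrightarrow>
     (\<integral>\<^sup>+y. shell_majorant \<epsilon> t x y * h y \<partial>M) \<le> ennreal (C * H)"
proof -
  define q where "q = (2::real) powr - \<epsilon>"
  have "0 < q" "q < 1" using assms powr_less_mono[of "-\<epsilon>" 0 2] by (auto simp: q_def)
  then obtain s where s: "0 < s" "(\<lambda>k. real (k + 1) * q ^ k) sums s" using geometric_linear_sums by blast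
  define C where "C = A * 2 powr \<epsilon> * s"
  have "(\<integral>\<^sup>+y. shell_majorant \<epsilon> t x y * h y \<partial>M) \<le> ennreal (C * H)"
    if t: "0 < t" and H: "0 \<le> H" and [measurable]: "h \<in> borel_measurable M" and
      h: "\<And>k. (\<integral>\<^sup>+y\<in>ball x (2 ^ k * t). h y \<partial>M) \<le> ennreal (real (k + 1) * H * vol M (2 ^ k * t) x)"
    for x t h H
  proof -
    have "(\<integral>\<^sup>+y. shell_majorant \<epsilon> t x y * h y \<partial>M) =
       (\<integral>\<^sup>+y. (\<Sum>k. ennreal (shell_weight \<epsilon> t x k) * (h y * indicator (ball x (2 ^ k * t)) y)) \<partial>M)"
      unfolding shell_majorant_def ennreal_suminf_multc[symmetric] by (simp add: ac_simps)
    also have "\<dots> = (\<Sum>k. ennreal (shell_weight \<epsilon> t x k) * (\<integral>\<^sup>+y\<in>ball x (2 ^ k * t). h y \<partial>M))"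
      by (subst nn_integral_suminf) (auto simp: nn_integral_cmult)
    also have "\<dots> \<le> (\<Sum>k. ennreal (A * 2 powr \<epsilon> * H * (real (k + 1) * q ^ k)))"
    proof (intro suminf_le allI)
      fix k
      have "0 < vol M (2 ^ k * t) x" using t by (intro vol_pos) simp
      then have eq: "shell_weight \<epsilon> t x k * (real (k + 1) * H * vol M (2 ^ k * t) x)
          = A * 2 powr \<epsilon> * H * (real (k + 1) * q ^ k)"
        by (simp add: shell_weight_def q_def)
      have "ennreal (shell_weight \<epsilon> t x k) * (\<integral>\<^sup>+y\<in>ball x (2 ^ k * t). h y \<partial>M)
         \<le> ennreal (shell_weight \<epsilon> t x k) * ennreal (real (k + 1) * H * vol M (2 ^ k * t) x)"
        by (intro mult_left_mono h) auto
      also have "\<dots> = ennreal (A * 2 powr \<epsilon> * H * (real (k + 1) * q ^ k))"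
        unfolding eq[symmetric] using shell_weight_nonneg H by (intro ennreal_mult[symmetric]) auto
      finally show "ennreal (shell_weight \<epsilon> t x k) * (\<integral>\<^sup>+y\<in>ball x (2 ^ k * t). h y \<partial>M)
         \<le> ennreal (A * 2 powr \<epsilon> * H * (real (k + 1) * q ^ k))" .
    qed auto
    also have "\<dots> = ennreal (A * 2 powr \<epsilon> * H * s)"
      using one_le_A H \<open>0 < q\<close> by (intro suminf_ennreal_eq sums_mult s) auto
    finally show ?thesis by (simp add: C_def ac_simps)
  qed
  moreover have "0 < C" using s one_le_A by (simp add: C_def)
  ultimately show ?thesis by blast
qed

lemma avg_dyadic:
  assumes f: "osc_bound f N" and t: "0 < t"
  shows "cmod (avg f x (2 ^ k * t) - avg f x t) \<le> real k * (A * N)"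
proof (induction k)
  case (Suc k)
  have kt: "0 < 2 ^ k * t" using t by simp
  have "cmod (avg f x (2 ^ k * t) - avg f x (2 * (2 ^ k * t))) \<le> A * N"
    using kt one_le_A doubling[OF kt, of x] by (intro avg_sub_ball[OF f]) auto
  then show ?case
    using Suc dist_triangle[of "avg f x (2 ^ Suc k * t)" "avg f x t" "avg f x (2 ^ k * t)"]
    by (simp add: dist_norm norm_minus_commute distrib_right mult.assoc)
qed simp

lemma osc_dyadic:
  assumes f: "osc_bound f N" and t: "0 < t"
  shows "(\<integral>\<^sup>+y\<in>ball x (2 ^ k * t). ennreal (cmod (f y - avg f x t)) \<partial>M)
    \<le> ennreal (real (k + 1) * (A * N) * vol M (2 ^ k * t) x)"
proof -
  have N: "0 < N" using f by (simp add: osc_bound_def)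
  have "N + cmod (avg f x (2 ^ k * t) - avg f x t) \<le> A * N + real k * (A * N)"
    using avg_dyadic[OF assms] mult_right_mono[OF one_le_A, of N] N by (intro add_mono) auto
  also have "\<dots> = real (k + 1) * (A * N)" by (simp add: algebra_simps)
  finally have "(N + cmod (avg f x (2 ^ k * t) - avg f x t)) * vol M (2 ^ k * t) x
      \<le> real (k + 1) * (A * N) * vol M (2 ^ k * t) x"
    by (intro mult_right_mono) auto
  then show ?thesis
    using osc_around[OF f, where r = "2 ^ k * t" and x = x and c = "avg f x t"] t by (auto intro: order_trans ennreal_leI)
qed

lemma shell_majorant_mass:
  assumes "0 < \<epsilon>" "0 < t" shows "(\<integral>\<^sup>+y. shell_majorant \<epsilon> t x y \<partial>M) < \<infinity>"
proof -
  obtain C where C: "\<forall>x t h H. 0 < t \<longrightarrow> 0 \<le> H \<longrightarrow> h \<in> borel_measurable M \<longrightarrow>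
     (\<forall>k. (\<integral>\<^sup>+y\<in>ball x (2 ^ k * t). h y \<partial>M) \<le> ennreal (real (k + 1) * H * vol M (2 ^ k * t) x)) \<longrightarrow>
     (\<integral>\<^sup>+y. shell_majorant \<epsilon> t x y * h y \<partial>M) \<le> ennreal (C * H)"
    using shell_majorant_integral[OF assms(1)] by blast
  have "(\<integral>\<^sup>+y\<in>ball x (2 ^ k * t). 1 \<partial>M) \<le> ennreal (real (k + 1) * 1 * vol M (2 ^ k * t) x)" for k
    using assms mult_right_mono[of 1 "real (k + 1)" "vol M (2 ^ k * t) x"]
    by (simp add: emeasure_ball ennreal_leI)
  then have "(\<integral>\<^sup>+y. shell_majorant \<epsilon> t x y * 1 \<partial>M) \<le> ennreal (C * 1)"
    using C[rule_format, of t 1 "\<lambda>_. 1" x] assms by auto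
  then show ?thesis by (auto simp: ennreal_less_top le_less_trans)
qed

lemma shell_majorant_osc:
  assumes "0 < \<epsilon>"
  shows "\<exists>C>0. \<forall>f N x t. osc_bound f N \<longrightarrow> 0 < t \<longrightarrow>
     (\<integral>\<^sup>+y. shell_majorant \<epsilon> t x y * ennreal (cmod (f y - avg f x t)) \<partial>M) \<le> ennreal (C * N)"
proof -
  obtain C where C: "0 < C" "\<forall>x t h H. 0 < t \<longrightarrow> 0 \<le> H \<longrightarrow> h \<in> borel_measurable M \<longrightarrow>
     (\<forall>k. (\<integral>\<^sup>+y\<in>ball x (2 ^ k * t). h y \<partial>M) \<le> ennreal (real (k + 1) * H * vol M (2 ^ k * t) x)) \<longrightarrow>
     (\<integral>\<^sup>+y. shell_majorant \<epsilon> t x y * h y \<partial>M) \<le> ennreal (C * H)"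
    using shell_majorant_integral[OF assms(1)] by blast
  have "(\<integral>\<^sup>+y. shell_majorant \<epsilon> t x y * ennreal (cmod (f y - avg f x t)) \<partial>M) \<le> ennreal (C * A * N)"
    if f: "osc_bound f N" and t: "0 < t" for f N x t
  proof -
    have [measurable]: "f \<in> borel_measurable M" and N: "0 < N"
      using f L1_loc_measurable by (auto simp: osc_bound_def)
    have "(\<integral>\<^sup>+y. shell_majorant \<epsilon> t x y * ennreal (cmod (f y - avg f x t)) \<partial>M) \<le> ennreal (C * (A * N))"
      using one_le_A N t osc_dyadic[OF f t] by (intro C(2)[rule_format]) auto
    then show ?thesis by (simp add: mult.assoc)
  qed
  moreover have "0 < C * A" using C one_le_A by simp
  ultimately show ?thesis by blast
qed

end

locale approx_identity = doubling_measure M A for M :: "'a::metric_space measure" and A :: real +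
  fixes \<epsilon>1 \<epsilon>2 A4 :: real and S :: "real \<Rightarrow> 'a \<Rightarrow> 'a \<Rightarrow> complex"
  assumes eps1: "0 < \<epsilon>1" and eps2: "0 < \<epsilon>2" and A4: "0 < A4"
    and kernel_measurable: "0 < t \<Longrightarrow> S t x \<in> borel_measurable M"
    and size: "0 < t \<Longrightarrow> cmod (S t x y) \<le> A4 * cai_bound M \<epsilon>2 t x y"
    and smooth: "0 < t \<Longrightarrow> dist x x' \<le> (t + dist x y) / 2 \<Longrightarrow>
      cmod (S t x y - S t x' y) \<le> A4 * (dist x x' / (t + dist x y)) powr \<epsilon>1 * cai_bound M \<epsilon>2 t x y"
    and mass: "0 < t \<Longrightarrow> has_bochner_integral M (S t x) 1"
begin

abbreviation T :: "real \<Rightarrow> ('a \<Rightarrow> complex) \<Rightarrow> 'a \<Rightarrow> complex" where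
  "T t f x \<equiv> kernel_op M (S t) f x"

lemma size_majorant:
  assumes "0 < t" "c \<ge> 0" "z \<le> c * (A4 * cai_bound M \<epsilon>2 t x y)"
  shows "ennreal z \<le> ennreal (c * A4) * shell_majorant \<epsilon>2 t x y"
proof -
  have "ennreal z \<le> ennreal (c * A4) * ennreal (cai_bound M \<epsilon>2 t x y)"
    using assms A4 by (subst ennreal_mult[symmetric]) (auto simp: cai_bound_def mult.assoc intro!: ennreal_leI)
  also have "\<dots> \<le> ennreal (c * A4) * shell_majorant \<epsilon>2 t x y"
    by (intro mult_left_mono cai_bound_le_shell_majorant assms eps2) auto
  finally show ?thesis .
qed

lemma majorant_abs_finite:
  assumes f: "osc_bound f N" and t: "0 < t"
  shows "(\<integral>\<^sup>+y. shell_majorant \<epsilon>2 t x y * ennreal (cmod (f y)) \<partial>M) < \<infinity>"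
proof -
  have [measurable]: "f \<in> borel_measurable M"
    using f L1_loc_measurable by (auto simp: osc_bound_def)
  obtain C where C: "(\<integral>\<^sup>+y. shell_majorant \<epsilon>2 t x y * ennreal (cmod (f y - avg f x t)) \<partial>M) \<le> ennreal (C * N)"
    using shell_majorant_osc[OF eps2] f t by blast
  let ?a = "ennreal (cmod (avg f x t))"
  have "(\<integral>\<^sup>+y. shell_majorant \<epsilon>2 t x y * ennreal (cmod (f y)) \<partial>M)
     \<le> (\<integral>\<^sup>+y. shell_majorant \<epsilon>2 t x y * ennreal (cmod (f y - avg f x t)) + ?a * shell_majorant \<epsilon>2 t x y \<partial>M)"
  proof (rule nn_integral_mono)
    fix y
    have "ennreal (cmod (f y)) \<le> ennreal (cmod (f y - avg f x t)) + ?a"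
      using norm_triangle_sub[of "f y" "avg f x t"]
      by (auto simp: ennreal_plus[symmetric] add.commute intro!: ennreal_leI simp del: ennreal_plus)
    then have "shell_majorant \<epsilon>2 t x y * ennreal (cmod (f y))
        \<le> shell_majorant \<epsilon>2 t x y * (ennreal (cmod (f y - avg f x t)) + ?a)"
      by (intro mult_left_mono) auto
    then show "shell_majorant \<epsilon>2 t x y * ennreal (cmod (f y))
        \<le> shell_majorant \<epsilon>2 t x y * ennreal (cmod (f y - avg f x t)) + ?a * shell_majorant \<epsilon>2 t x y"
      by (simp add: distrib_left mult.commute)
  qed
  also have "\<dots> = (\<integral>\<^sup>+y. shell_majorant \<epsilon>2 t x y * ennreal (cmod (f y - avg f x t)) \<partial>M)
      + ?a * (\<integral>\<^sup>+y. shell_majorant \<epsilon>2 t x y \<partial>M)"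
    by (subst nn_integral_add) (auto simp: nn_integral_cmult)
  also have "\<dots> < \<infinity>"
    using C shell_majorant_mass[OF eps2 t, of x]
    by (auto simp: ennreal_mult_less_top intro: le_less_trans)
  finally show ?thesis .
qed

lemma kernel_integrable:
  assumes f: "osc_bound f N" and t: "0 < t"
  shows "integrable M (\<lambda>y. S t x y * f y)"
proof (rule integrableI_bounded)
  have [measurable]: "f \<in> borel_measurable M" "S t x \<in> borel_measurable M"
    using f L1_loc_measurable kernel_measurable t by (auto simp: osc_bound_def)
  show "(\<lambda>y. S t x y * f y) \<in> borel_measurable M" by measurable
  have "(\<integral>\<^sup>+y. ennreal (norm (S t x y * f y)) \<partial>M)
     \<le> (\<integral>\<^sup>+y. ennreal A4 * (shell_majorant \<epsilon>2 t x y * ennreal (cmod (f y))) \<partial>M)"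
  proof (rule nn_integral_mono)
    fix y
    show "ennreal (norm (S t x y * f y)) \<le> ennreal A4 * (shell_majorant \<epsilon>2 t x y * ennreal (cmod (f y)))"
      using mult_right_mono[OF size_majorant[OF t, of 1 "cmod (S t x y)" x y], of "ennreal (cmod (f y))"]
        size[OF t, of x y] by (simp add: norm_mult ennreal_mult mult.assoc)
  qed
  also have "\<dots> = ennreal A4 * (\<integral>\<^sup>+y. shell_majorant \<epsilon>2 t x y * ennreal (cmod (f y)) \<partial>M)"
    by (intro nn_integral_cmult) measurable
  also have "\<dots> < \<infinity>"
    using majorant_abs_finite[OF assms, of x] by (simp add: ennreal_mult_less_top)
  finally show "(\<integral>\<^sup>+y. ennreal (norm (S t x y * f y)) \<partial>M) < \<infinity>" .
qed

text \<open>The integral of the kernel is 1, so the difference is the integral of the kernel against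
  \<open>f - avg f x t\<close>, and this is bounded through the majorant.\<close>

lemma T_near_avg:
  "\<exists>C>0. \<forall>f N x t. osc_bound f N \<longrightarrow> 0 < t \<longrightarrow> cmod (T t f x - avg f x t) \<le> C * N"
proof -
  obtain C where C: "0 < C" "\<And>f N x t. osc_bound f N \<Longrightarrow> 0 < t \<Longrightarrow>
     (\<integral>\<^sup>+y. shell_majorant \<epsilon>2 t x y * ennreal (cmod (f y - avg f x t)) \<partial>M) \<le> ennreal (C * N)"
    using shell_majorant_osc[OF eps2] by blast
  have "cmod (T t f x - avg f x t) \<le> A4 * C * N" if f: "osc_bound f N" and t: "0 < t" for f N x t
  proof -
    have [measurable]: "f \<in> borel_measurable M" "S t x \<in> borel_measurable M"
      using f L1_loc_measurable kernel_measurable t by (auto simp: osc_bound_def)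
    have N: "0 < N" using f by (simp add: osc_bound_def)
    let ?a = "avg f x t"
    have intS: "has_bochner_integral M (\<lambda>y. S t x y * ?a) ?a"
      using has_bochner_integral_mult_left[OF mass[OF t, of x], of ?a] by simp
    have int: "integrable M (\<lambda>y. S t x y * f y - S t x y * ?a)"
      using kernel_integrable[OF f t] intS by (intro Bochner_Integration.integrable_diff) (auto simp: has_bochner_integral_iff)
    have eq: "T t f x - ?a = (LINT y|M. S t x y * f y - S t x y * ?a)"
      using kernel_integrable[OF f t] intS by (simp add: kernel_op_def has_bochner_integral_iff)
    have "ennreal (cmod (T t f x - ?a)) \<le> (\<integral>\<^sup>+y. ennreal (cmod (S t x y * f y - S t x y * ?a)) \<partial>M)"
      unfolding eq by (rule integral_norm_bound_ennreal[OF int])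
    also have "\<dots> \<le> (\<integral>\<^sup>+y. ennreal A4 * (shell_majorant \<epsilon>2 t x y * ennreal (cmod (f y - ?a))) \<partial>M)"
    proof (rule nn_integral_mono)
      fix y
      show "ennreal (cmod (S t x y * f y - S t x y * ?a)) \<le> ennreal A4 * (shell_majorant \<epsilon>2 t x y * ennreal (cmod (f y - ?a)))"
        using mult_right_mono[OF size_majorant[OF t, of 1 "cmod (S t x y)" x y], of "ennreal (cmod (f y - ?a))"]
          size[OF t, of x y] by (simp add: norm_mult ennreal_mult mult.assoc flip: right_diff_distrib)
    qed
    also have "\<dots> = ennreal A4 * (\<integral>\<^sup>+y. shell_majorant \<epsilon>2 t x y * ennreal (cmod (f y - ?a)) \<partial>M)"
      by (intro nn_integral_cmult) measurable
    also have "\<dots> \<le> ennreal A4 * ennreal (C * N)"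
      by (intro mult_left_mono C f t) auto
    also have "\<dots> = ennreal (A4 * C * N)" using A4 C N by (simp add: ennreal_mult[symmetric] mult.assoc)
    finally show ?thesis using A4 C N by (simp add: ennreal_le_iff)
  qed
  moreover have "0 < A4 * C" using A4 C by simp
  ultimately show ?thesis by blast
qed

text \<open>Continuity serves measurability: suprema of \<open>S\<^sub>t f\<close> over uncountably many \<open>t\<close> are lower
  semicontinuous, although nothing is assumed about the dependence of \<open>S\<^sub>t\<close> on \<open>t\<close>.\<close>

lemma T_continuous:
  assumes f: "osc_bound f N" and t: "0 < t"
  shows "continuous_on UNIV (T t f)"
proof (rule continuous_at_imp_continuous_on, rule ballI)
  fix x
  have [measurable]: "f \<in> borel_measurable M" "\<And>x. S t x \<in> borel_measurable M"
    using f L1_loc_measurable kernel_measurable t by (auto simp: osc_bound_def)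
  define J where "J = enn2real (\<integral>\<^sup>+y. shell_majorant \<epsilon>2 t x y * ennreal (cmod (f y)) \<partial>M)"
  have J: "(\<integral>\<^sup>+y. shell_majorant \<epsilon>2 t x y * ennreal (cmod (f y)) \<partial>M) = ennreal J" "0 \<le> J"
    using majorant_abs_finite[OF f t, of x] by (auto simp: J_def less_top)
  have bound: "cmod (T t f x' - T t f x) \<le> (dist x x' / t) powr \<epsilon>1 * (A4 * J)"
    if close: "dist x x' \<le> t / 2" for x'
  proof -
    define c where "c = (dist x x' / t) powr \<epsilon>1"
    have c: "0 \<le> c" by (simp add: c_def)
    have int: "integrable M (\<lambda>y. S t x y * f y - S t x' y * f y)"
      using kernel_integrable[OF f t] by (intro Bochner_Integration.integrable_diff)
    have "cmod (T t f x' - T t f x) = cmod (LINT y|M. S t x y * f y - S t x' y * f y)"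
      using kernel_integrable[OF f t] by (simp add: kernel_op_def norm_minus_commute)
    then have "ennreal (cmod (T t f x' - T t f x)) \<le> (\<integral>\<^sup>+y. ennreal (cmod (S t x y * f y - S t x' y * f y)) \<partial>M)"
      using integral_norm_bound_ennreal[OF int] by simp
    also have "\<dots> \<le> (\<integral>\<^sup>+y. ennreal (c * A4) * (shell_majorant \<epsilon>2 t x y * ennreal (cmod (f y))) \<partial>M)"
    proof (rule nn_integral_mono)
      fix y
      have "t / 2 \<le> (t + dist x y) / 2" by simp
      with close have "dist x x' \<le> (t + dist x y) / 2" by (rule order_trans)
      then have "cmod (S t x y - S t x' y)
          \<le> A4 * (dist x x' / (t + dist x y)) powr \<epsilon>1 * cai_bound M \<epsilon>2 t x y"
        by (rule smooth[OF t])
      also have "\<dots> \<le> A4 * c * cai_bound M \<epsilon>2 t x y"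
        unfolding c_def using t eps1 A4
        by (intro mult_right_mono mult_left_mono powr_mono2 divide_left_mono)
          (auto simp: cai_bound_def add_pos_nonneg)
      finally have "cmod (S t x y - S t x' y) \<le> c * (A4 * cai_bound M \<epsilon>2 t x y)" by (simp add: ac_simps)
      from mult_right_mono[OF size_majorant[OF t c this], of "ennreal (cmod (f y))"]
      show "ennreal (cmod (S t x y * f y - S t x' y * f y))
          \<le> ennreal (c * A4) * (shell_majorant \<epsilon>2 t x y * ennreal (cmod (f y)))"
        by (simp add: norm_mult ennreal_mult[symmetric] mult.assoc flip: left_diff_distrib)
    qed
    also have "\<dots> = ennreal (c * A4) * ennreal J"
      unfolding J(1)[symmetric] by (intro nn_integral_cmult) measurable
    also have "\<dots> = ennreal (c * (A4 * J))" using A4 c J by (simp add: ennreal_mult[symmetric] mult.assoc)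
    finally show ?thesis using A4 c J by (simp add: ennreal_le_iff c_def)
  qed
  have lim: "((\<lambda>x'. (dist x x' / t) powr \<epsilon>1 * (A4 * J)) \<longlongrightarrow> 0) (at x)"
  proof (rule tendsto_mult_left_zero, rule tendsto_zero_powrI)
    have "((\<lambda>x'. dist x x' / t) \<longlongrightarrow> dist x x / t) (at x)" using t by (intro tendsto_intros) auto
    then show "((\<lambda>x'. dist x x' / t) \<longlongrightarrow> 0) (at x)" by simp
  qed (use eps1 t in auto)
  have "\<forall>\<^sub>F x' in at x. dist x x' \<le> t / 2"
    using t unfolding eventually_at by (intro exI[of _ "t / 2"]) (auto simp: dist_commute)
  then have "\<forall>\<^sub>F x' in at x. norm (T t f x' - T t f x) \<le> (dist x x' / t) powr \<epsilon>1 * (A4 * J)"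
    by (rule eventually_mono) (use bound in auto)
  then have "((\<lambda>x'. T t f x' - T t f x) \<longlongrightarrow> 0) (at x)"
    using lim by (rule Lim_null_comparison)
  then show "isCont (T t f) x" unfolding isCont_def using LIM_zero_cancel by blast
qed

text \<open>This is the form in which the kernels enter everything below: on comparable scales and at
  comparable points, operators and means agree up to a multiple of the BMO norm.\<close>

lemma T_comparable_avg:
  assumes "1 \<le> \<Lambda>"
  shows "\<exists>K>0. \<forall>f N x y r s. osc_bound f N \<longrightarrow> 0 < r \<longrightarrow> 0 < s \<longrightarrow>
     dist x y \<le> \<Lambda> * r \<longrightarrow> s \<le> \<Lambda> * r \<longrightarrow> r \<le> \<Lambda> * s \<longrightarrow>
     cmod (T r f x - avg f y s) \<le> K * N \<and> cmod (T r f x - T s f y) \<le> K * N"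
proof -
  obtain K where K: "0 < K" "\<And>f N x y r s. osc_bound f N \<Longrightarrow> 0 < r \<Longrightarrow> 0 < s \<Longrightarrow>
     dist x y \<le> \<Lambda> * r \<Longrightarrow> s \<le> \<Lambda> * r \<Longrightarrow> r \<le> \<Lambda> * s \<Longrightarrow> cmod (avg f x r - avg f y s) \<le> K * N"
    using avg_comparable[OF assms] by blast
  obtain C where C: "0 < C" "\<And>f N x t. osc_bound f N \<Longrightarrow> 0 < t \<Longrightarrow> cmod (T t f x - avg f x t) \<le> C * N"
    using T_near_avg by blast
  have "cmod (T r f x - avg f y s) \<le> (K + 2 * C) * N \<and> cmod (T r f x - T s f y) \<le> (K + 2 * C) * N"
    if H: "osc_bound f N" "0 < r" "0 < s" "dist x y \<le> \<Lambda> * r" "s \<le> \<Lambda> * r" "r \<le> \<Lambda> * s" for f N x y r s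
  proof -
    have N: "0 < N" using H by (simp add: osc_bound_def)
    have 1: "dist (T r f x) (avg f x r) \<le> C * N" "dist (T s f y) (avg f y s) \<le> C * N"
      using C(2) H by (auto simp: dist_norm)
    have 2: "dist (avg f x r) (avg f y s) \<le> K * N" using K(2)[OF H] by (simp add: dist_norm)
    have 3: "dist (T r f x) (avg f y s) \<le> K * N + C * N"
      using 1 2 dist_triangle[of "T r f x" "avg f y s" "avg f x r"] by linarith
    have 4: "dist (T r f x) (T s f y) \<le> K * N + C * N + C * N"
      using 1 3 dist_triangle2[of "T r f x" "T s f y" "avg f y s"] by linarith
    have "0 < C * N" using C N by simp
    then show ?thesis using 3 4 by (simp add: dist_norm algebra_simps)
  qed
  moreover have "0 < K + 2 * C" using K C by simp
  ultimately show ?thesis by blast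
qed

end

section \<open>The local maximal function\<close>

context doubling_measure begin

lemma vitali_sequence:
  fixes t :: "'a \<Rightarrow> real"
  assumes t: "\<And>x. x \<in> E \<Longrightarrow> 0 < t x \<and> t x \<le> R"
    and Q: "Q \<in> sets M" "emeasure M Q < \<infinity>" "\<And>x. x \<in> E \<Longrightarrow> ball x (t x) \<subseteq> Q"
  obtains c :: "nat \<Rightarrow> 'a" and J where "c ` J \<subseteq> E"
    "disjoint_family_on (\<lambda>i. ball (c i) (t (c i))) J"
    "E \<subseteq> (\<Union>i\<in>J. ball (c i) (4 * t (c i)))"
proof -
  obtain C where C: "C \<subseteq> E" "disjoint_family_on (\<lambda>c. ball c (t c)) C"
    "E \<subseteq> (\<Union>c\<in>C. ball c (4 * t c))"
    using vitali_selection[of E t R] t by blast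
  have "countable C"
  proof (rule countable_disjoint_positive_measure[OF C(2)])
    show "0 < measure M (ball c (t c))" if "c \<in> C" for c
      using vol_pos[of "t c" c] t C(1) that by (auto simp: vol_def)
  qed (use C(1) Q in auto)
  show ?thesis
  proof
    have img: "from_nat_into C ` to_nat_on C ` C = C"
      using \<open>countable C\<close> by (force simp: image_image)
    show "from_nat_into C ` to_nat_on C ` C \<subseteq> E" using C(1) img by simp
    show "E \<subseteq> (\<Union>i\<in>to_nat_on C ` C. ball (from_nat_into C i) (4 * t (from_nat_into C i)))"
      using C(3) \<open>countable C\<close> by simp
    show "disjoint_family_on (\<lambda>i. ball (from_nat_into C i) (t (from_nat_into C i))) (to_nat_on C ` C)"
      using C(2) \<open>countable C\<close> unfolding disjoint_family_on_def by (auto dest: inj_onD)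
  qed
qed

end

context approx_identity begin

definition local_max :: "('a \<Rightarrow> complex) \<Rightarrow> 'a \<Rightarrow> real \<Rightarrow> 'a \<Rightarrow> ennreal" where
  "local_max f x r y = (SUP t\<in>{0<..r}. ennreal (cmod (T t f y - avg f x r)))"

text \<open>The superlevel sets are unions of open sets, hence open, however large the index set is.\<close>

lemma SUP_T_measurable:
  assumes f: "osc_bound f N" and D: "D \<subseteq> {0<..}"
  shows "(\<lambda>y. SUP t\<in>D. ennreal (cmod (T t f y - c))) \<in> borel_measurable M"
proof (rule borel_measurableI_greater)
  fix z
  have "{y \<in> space M. z < (SUP t\<in>D. ennreal (cmod (T t f y - c)))}
      = (\<Union>t\<in>D. {y. z < ennreal (cmod (T t f y - c))})"
    by (auto simp: less_SUP_iff)
  moreover have "open {y. z < ennreal (cmod (T t f y - c))}" if "t \<in> D" for t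
    using D that
    by (intro open_Collect_less continuous_on_ennreal continuous_intros T_continuous[OF f]) auto
  ultimately show "{y \<in> space M. z < (SUP t\<in>D. ennreal (cmod (T t f y - c)))} \<in> sets M"
    by (simp add: sets_M open_UN)
qed

lemma local_max_measurable: "osc_bound f N \<Longrightarrow> local_max f x r \<in> borel_measurable M"
  unfolding local_max_def[abs_def] by (rule SUP_T_measurable) auto

text \<open>The step of a John--Nirenberg argument carried out directly on the maximal function. Let \<open>a\<close> be the
  mean over \<open>B = B(x,r)\<close>, and let \<open>E\<close> be the part of \<open>B\<close> where \<open>\<bar>S\<^sub>t f - a\<bar>\<close> exceeds a height
  \<open>lam\<close>, a large multiple of \<open>N\<close>, for some \<open>t \<le> r\<close>. To each point of \<open>E\<close> belongs an almost maximal
  radius \<open>t\<close> of this kind. Because \<open>S\<^sub>t f\<close> is close to the mean, the integral of \<open>\<bar>f - a\<bar>\<close>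
  over the ball of radius \<open>t\<close> is large, so the balls of four times the radius belonging to a disjoint
  Vitali selection have total measure at most half that of \<open>B\<close>. Outside \<open>E\<close> the maximal function
  is at most \<open>lam\<close>. On a selected ball it exceeds the maximal function of that ball by at most a
  multiple of \<open>N\<close>: larger radii are beyond the stopping radius, where \<open>\<bar>S\<^sub>t f - a\<bar>\<close> is at most
  \<open>lam\<close>, and the mean over the selected ball is close to \<open>a\<close>, for the same reason or because the selected ball
  is comparable with \<open>B\<close>. Hence a bound \<open>\<phi>\<close> for the
  truncated means over all balls improves to half of \<open>\<phi>\<close> plus a multiple of \<open>N\<close>.\<close>

lemma stopping_time_step:
  "\<exists>k>0. \<forall>f N L \<phi> x r. osc_bound f N \<longrightarrow> 0 \<le> \<phi> \<longrightarrow> 0 < r \<longrightarrow>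
     (\<forall>x r. 0 < r \<longrightarrow> (\<integral>\<^sup>+y\<in>ball x r. min (local_max f x r y) L \<partial>M) \<le> ennreal (\<phi> * vol M r x)) \<longrightarrow>
     (\<integral>\<^sup>+y\<in>ball x r. min (local_max f x r y) L \<partial>M) \<le> ennreal ((k * N + \<phi> / 2) * vol M r x)"
proof -
  obtain K where K: "0 < K"
    and TA: "\<And>f N x y r s. osc_bound f N \<Longrightarrow> 0 < r \<Longrightarrow> 0 < s \<Longrightarrow>
     dist x y \<le> 5 * r \<Longrightarrow> s \<le> 5 * r \<Longrightarrow> r \<le> 5 * s \<Longrightarrow> dist (T r f x) (avg f y s) \<le> K * N"
    and TT: "\<And>f N x y r s. osc_bound f N \<Longrightarrow> 0 < r \<Longrightarrow> 0 < s \<Longrightarrow>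
     dist x y \<le> 5 * r \<Longrightarrow> s \<le> 5 * r \<Longrightarrow> r \<le> 5 * s \<Longrightarrow> dist (T r f x) (T s f y) \<le> K * N"
    using T_comparable_avg[of 5] unfolding dist_norm by auto
  \<comment> \<open>The total measure of the selected balls comes out as \<open>A\<^sup>3 (1 + A) / W\<close> times that of the given ball; this \<open>W\<close> makes it one half.\<close>
  define W where "W = 2 * A ^ 3 * (1 + A)"
  have W: "0 < W" using one_le_A by (simp add: W_def)
  define k1 where "k1 = W + 2 * K"
  define k where "k = W + K + k1 / 2"
  have k1: "0 < k1" and k: "0 < k" using W K by (simp_all add: k1_def k_def add_pos_pos)
  have "(\<integral>\<^sup>+y\<in>ball x0 r. min (local_max f x0 r y) L \<partial>M) \<le> ennreal ((k * N + \<phi> / 2) * vol M r x0)"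
    if f: "osc_bound f N" and \<phi>: "0 \<le> \<phi>" and r: "0 < r" and
      IH: "\<And>x r. 0 < r \<Longrightarrow> (\<integral>\<^sup>+y\<in>ball x r. min (local_max f x r y) L \<partial>M) \<le> ennreal (\<phi> * vol M r x)"
    for f N L \<phi> x0 r
  proof -
    have fm [measurable]: "f \<in> borel_measurable M" and N: "0 < N" and L1: "f \<in> L1_loc M"
      using f L1_loc_measurable by (auto simp: osc_bound_def)
    note [measurable] = local_max_measurable[OF f]
    define a where "a = avg f x0 r"
    define lam where "lam = (W + K) * N"
    define bad where "bad x t \<longleftrightarrow> 0 < t \<and> t \<le> r \<and> lam < dist (T t f x) a" for x t
    define E where "E = {x \<in> ball x0 r. \<exists>t. bad x t}"
    have "\<exists>t. bad x t \<and> (\<forall>s. 2 * t < s \<longrightarrow> \<not> bad x s)" if "x \<in> E" for x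
    proof -
      let ?D = "Collect (bad x)"
      have ne: "?D \<noteq> {}" using that by (auto simp: E_def)
      have bdd: "bdd_above ?D" by (auto simp: bad_def bdd_above_def)
      have up: "s \<le> Sup ?D" if "bad x s" for s using that bdd by (auto intro: cSup_upper)
      obtain s where "bad x s" using ne by auto
      then have "Sup ?D / 2 < Sup ?D" using up[of s] by (simp add: bad_def)
      then have "\<exists>t\<in>?D. Sup ?D / 2 < t"
        using less_cSup_iff[OF ne bdd, of "Sup ?D / 2"] by blast
      then obtain t where t: "bad x t" "Sup ?D / 2 < t" by blast
      have "\<not> bad x s" if "2 * t < s" for s
        using up[of s] t(2) that by fastforce
      with t show ?thesis by blast
    qed
    then obtain tt where tt: "\<And>x. x \<in> E \<Longrightarrow> bad x (tt x)" "\<And>x s. x \<in> E \<Longrightarrow> 2 * tt x < s \<Longrightarrow> \<not> bad x s"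
      by metis
    have tt_pos: "0 < tt x" "tt x \<le> r" if "x \<in> E" for x using tt(1)[OF that] by (auto simp: bad_def)
    have sub2: "ball x (tt x) \<subseteq> ball x0 (2 * r)" if "x \<in> E" for x
    proof
      fix z assume "z \<in> ball x (tt x)"
      then show "z \<in> ball x0 (2 * r)"
        using that tt_pos[OF that] dist_triangle[of x0 z x] unfolding E_def mem_ball by fastforce
    qed
    have fin2: "emeasure M (ball x0 (2 * r)) < \<infinity>" using ball_fin r by simp
    obtain c :: "nat \<Rightarrow> 'a" and J where cJ: "c ` J \<subseteq> E"
      and disj: "disjoint_family_on (\<lambda>i. ball (c i) (tt (c i))) J"
      and cover: "E \<subseteq> (\<Union>i\<in>J. ball (c i) (4 * tt (c i)))"
      by (rule vitali_sequence[of E tt r "ball x0 (2 * r)"]) (use tt_pos sub2 fin2 in simp_all)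
    have cE: "c i \<in> E" if "i \<in> J" for i using cJ that by auto
    \<comment> \<open>Empty sets fill the unused indices, so that plain series over the naturals can be used.\<close>
    define X where "X i = (if i \<in> J then ball (c i) (tt (c i)) else {})" for i
    define U where "U i = (if i \<in> J then ball (c i) (4 * tt (c i)) else {})" for i
    have [measurable]: "X i \<in> sets M" "U i \<in> sets M" for i by (auto simp: X_def U_def)
    let ?h = "\<lambda>y. ennreal (cmod (f y - a))"
    have small: "emeasure M (U i) \<le> ennreal (A\<^sup>2 / (W * N)) * (\<integral>\<^sup>+y\<in>X i. ?h y \<partial>M)" for i
    proof (cases "i \<in> J")
      case True
      define t where "t = tt (c i)"
      have t: "0 < t" "t \<le> r" "lam < dist (T t f (c i)) a"
        using tt(1)[OF cE[OF True]] by (auto simp: t_def bad_def)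
      have "\<not> (\<integral>\<^sup>+y\<in>ball (c i) t. ?h y \<partial>M) \<le> ennreal (W * N * vol M t (c i))"
      proof
        assume "(\<integral>\<^sup>+y\<in>ball (c i) t. ?h y \<partial>M) \<le> ennreal (W * N * vol M t (c i))"
        then have "dist (avg f (c i) t) a \<le> W * N"
          unfolding dist_norm using W N by (intro avg_close[OF L1 t(1) order_refl]) auto
        moreover have "dist (T t f (c i)) (avg f (c i) t) \<le> K * N" using t by (intro TA[OF f]) auto
        ultimately have "dist (T t f (c i)) a \<le> lam"
          using dist_triangle[of "T t f (c i)" a "avg f (c i) t"] by (simp add: lam_def distrib_right)
        then show False using t by simp
      qed
      then have low: "ennreal (W * N * vol M t (c i)) \<le> (\<integral>\<^sup>+y\<in>X i. ?h y \<partial>M)"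
        using True by (simp add: X_def t_def)
      have "vol M (4 * t) (c i) \<le> A\<^sup>2 * vol M t (c i)"
        using vol_power[OF t(1), of 2 "c i"] by simp
      also have "\<dots> = A\<^sup>2 / (W * N) * (W * N * vol M t (c i))" using W N by simp
      finally have "emeasure M (U i) \<le> ennreal (A\<^sup>2 / (W * N) * (W * N * vol M t (c i)))"
        using True t by (simp add: U_def emeasure_ball ennreal_leI flip: t_def)
      also have "\<dots> = ennreal (A\<^sup>2 / (W * N)) * ennreal (W * N * vol M t (c i))"
        using W N by (intro ennreal_mult) auto
      also have "\<dots> \<le> ennreal (A\<^sup>2 / (W * N)) * (\<integral>\<^sup>+y\<in>X i. ?h y \<partial>M)"
        by (intro mult_left_mono low) auto
      finally show ?thesis .
    qed (simp add: U_def)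
    have half: "(\<Sum>i. emeasure M (U i)) \<le> ennreal (vol M r x0 / 2)"
    proof -
      have dX: "disjoint_family X"
        using disj by (auto simp: disjoint_family_on_def X_def)
      have "(\<Sum>i. \<integral>\<^sup>+y\<in>X i. ?h y \<partial>M) = (\<integral>\<^sup>+y. (\<Sum>i. ?h y * indicator (X i) y) \<partial>M)"
        by (intro nn_integral_suminf[symmetric]) measurable
      also have "\<dots> = (\<integral>\<^sup>+y. ?h y * indicator (\<Union>i. X i) y \<partial>M)"
        by (simp add: ennreal_suminf_cmult suminf_indicator[OF dX])
      also have "\<dots> \<le> (\<integral>\<^sup>+y\<in>ball x0 (2 * r). ?h y \<partial>M)"
      proof (rule nn_integral_mono)
        fix y
        have "(\<Union>i. X i) \<subseteq> ball x0 (2 * r)" using sub2 cE by (auto simp: X_def split: if_splits)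
        then have "indicator (\<Union>i. X i) y \<le> (indicator (ball x0 (2 * r)) y :: ennreal)"
          unfolding indicator_def by (simp add: subset_iff)
        then show "?h y * indicator (\<Union>i. X i) y \<le> ?h y * indicator (ball x0 (2 * r)) y"
          by (rule mult_left_mono) simp
      qed
      also have "\<dots> \<le> ennreal ((N + cmod (avg f x0 (2 * r) - a)) * vol M (2 * r) x0)"
        using r by (intro osc_around[OF f]) simp
      also have "\<dots> \<le> ennreal ((N + A * N) * (A * vol M r x0))"
      proof (intro ennreal_leI mult_mono add_left_mono)
        have "cmod (avg f x0 r - avg f x0 (2 * r)) \<le> A * N"
          using r one_le_A doubling[OF r] by (intro avg_sub_ball[OF f]) auto
        then show "cmod (avg f x0 (2 * r) - a) \<le> A * N" by (simp add: a_def norm_minus_commute)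
      qed (use doubling[OF r] N one_le_A in auto)
      finally have sumX: "(\<Sum>i. \<integral>\<^sup>+y\<in>X i. ?h y \<partial>M) \<le> ennreal ((N + A * N) * (A * vol M r x0))" .
      have "(\<Sum>i. emeasure M (U i)) \<le> (\<Sum>i. ennreal (A\<^sup>2 / (W * N)) * (\<integral>\<^sup>+y\<in>X i. ?h y \<partial>M))"
        by (intro suminf_le allI small) auto
      also have "\<dots> = ennreal (A\<^sup>2 / (W * N)) * (\<Sum>i. \<integral>\<^sup>+y\<in>X i. ?h y \<partial>M)"
        by (rule ennreal_suminf_cmult)
      also have "\<dots> \<le> ennreal (A\<^sup>2 / (W * N)) * ennreal ((N + A * N) * (A * vol M r x0))"
        by (intro mult_left_mono sumX) auto
      also have "\<dots> = ennreal (A\<^sup>2 / (W * N) * ((N + A * N) * (A * vol M r x0)))"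
        using W N one_le_A by (intro ennreal_mult[symmetric]) auto
      also have "A\<^sup>2 / (W * N) * ((N + A * N) * (A * vol M r x0)) = vol M r x0 / 2"
      proof -
        obtain P where P: "P = 1 + A" by simp
        have nz: "A \<noteq> 0" "P \<noteq> 0" "N \<noteq> 0" using one_le_A N P by auto
        have "A\<^sup>2 / (2 * A ^ 3 * P * N) * (P * N * (A * vol M r x0)) = vol M r x0 / 2"
          using nz by (simp add: divide_simps power2_eq_square power3_eq_cube)
        then show ?thesis by (simp add: W_def P distrib_right)
      qed
      finally show ?thesis .
    qed
    define gi where "gi i = local_max f (c i) (4 * tt (c i))" for i
    have [measurable]: "gi i \<in> borel_measurable M" for i by (simp add: gi_def)
    have inherit: "local_max f x0 r y \<le> gi i y + ennreal (k1 * N)"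
      if i: "i \<in> J" and y: "y \<in> U i" for i y
      unfolding local_max_def a_def[symmetric]
    proof (rule SUP_least)
      fix s assume s: "s \<in> {0<..r}"
      define t where "t = tt (c i)"
      define b where "b = avg f (c i) (4 * t)"
      have ci: "c i \<in> E" "dist x0 (c i) < r" using cE[OF i] by (auto simp: E_def)
      have t: "0 < t" "t \<le> r" using tt_pos[OF ci(1)] by (auto simp: t_def)
      have yt: "dist y (c i) < 4 * t" using y i by (simp add: U_def t_def dist_commute)
      have stop: "dist (T u f (c i)) a \<le> lam" if "2 * t < u" "u \<le> r" for u
        using tt(2)[OF ci(1), of u] that t by (force simp: t_def bad_def)
      have KN: "0 < K * N" "0 < W * N" using K N W by auto
      have Tb: "dist (T (4 * t) f (c i)) b \<le> K * N"
        unfolding b_def using t by (intro TA[OF f]) auto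
      \<comment> \<open>Either \<open>4t\<close> is past the stopping radius, or it exceeds \<open>r\<close> and the selected ball is comparable with the given one.\<close>
      have "dist (T (4 * t) f (c i)) a \<le> lam"
      proof (cases "4 * t \<le> r")
        case True then show ?thesis using t by (intro stop) auto
      next
        case False
        then have "dist (T (4 * t) f (c i)) a \<le> K * N"
          unfolding a_def using t r ci(2) by (intro TA[OF f]) (auto simp: dist_commute)
        then show ?thesis using KN by (simp add: lam_def distrib_right)
      qed
      then have ba: "dist b a \<le> k1 * N"
        using Tb dist_triangle3[of b a "T (4 * t) f (c i)"] by (simp add: lam_def k1_def distrib_right)
      show "ennreal (cmod (T s f y - a)) \<le> gi i y + ennreal (k1 * N)"
      proof (cases "s \<le> 4 * t")
        case True
        have "cmod (T s f y - a) \<le> cmod (T s f y - b) + k1 * N"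
          using ba dist_triangle[of "T s f y" a b] by (simp add: dist_norm)
        then have "ennreal (cmod (T s f y - a)) \<le> ennreal (cmod (T s f y - b)) + ennreal (k1 * N)"
          using k1 N by (simp add: ennreal_leI flip: ennreal_plus)
        also have "\<dots> \<le> gi i y + ennreal (k1 * N)"
          unfolding gi_def local_max_def t_def[symmetric] b_def[symmetric]
          using s True by (intro add_right_mono SUP_upper) auto
        finally show ?thesis .
      next
        case False
        have "dist (T s f y) (T s f (c i)) \<le> K * N" using False s yt by (intro TT[OF f]) auto
        moreover have "dist (T s f (c i)) a \<le> lam" using False s t by (intro stop) auto
        ultimately have "cmod (T s f y - a) \<le> k1 * N"
          using dist_triangle[of "T s f y" a "T s f (c i)"]
          by (simp add: dist_norm lam_def k1_def distrib_right)
        then show ?thesis by (intro add_increasing ennreal_leI) auto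
      qed
    qed
    have point: "min (local_max f x0 r y) L * indicator (ball x0 r) y \<le>
        ennreal lam * indicator (ball x0 r) y +
        (\<Sum>i. (min (gi i y) L + ennreal (k1 * N)) * indicator (U i) y)" for y
    proof (cases "y \<in> ball x0 r")
      case in_ball: True
      show ?thesis
      proof (cases "y \<in> E")
        case True
        then obtain i where i: "i \<in> J" "y \<in> U i" using cover by (auto simp: U_def)
        have "min (local_max f x0 r y) L \<le> min (gi i y + ennreal (k1 * N)) L"
          by (intro min.mono inherit i order_refl)
        also have "\<dots> \<le> min (gi i y) L + ennreal (k1 * N)"
          by (cases "gi i y \<le> L") (simp_all add: min_absorb1 min_absorb2 min.coboundedI2 add_increasing2)
        also have "\<dots> = (\<Sum>i\<in>{i}. (min (gi i y) L + ennreal (k1 * N)) * indicator (U i) y)"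
          using i by simp
        also have "\<dots> \<le> (\<Sum>i. (min (gi i y) L + ennreal (k1 * N)) * indicator (U i) y)"
          by (intro sum_le_suminf) auto
        finally show ?thesis using in_ball by (simp add: add_increasing)
      next
        case False
        then have "local_max f x0 r y \<le> ennreal lam"
          unfolding local_max_def a_def[symmetric]
          using in_ball by (intro SUP_least ennreal_leI) (force simp: E_def bad_def dist_norm)
        then show ?thesis using in_ball by (simp add: add_increasing2 min.coboundedI1)
      qed
    qed simp
    have piece: "(\<integral>\<^sup>+y. (min (gi i y) L + ennreal (k1 * N)) * indicator (U i) y \<partial>M)
        \<le> ennreal (\<phi> + k1 * N) * emeasure M (U i)" for i
    proof (cases "i \<in> J")
      case True
      have t: "0 < 4 * tt (c i)" using tt_pos cE[OF True] by simp
      have "(\<integral>\<^sup>+y. (min (gi i y) L + ennreal (k1 * N)) * indicator (U i) y \<partial>M)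
         = (\<integral>\<^sup>+y\<in>U i. min (gi i y) L \<partial>M) + ennreal (k1 * N) * emeasure M (U i)"
        by (simp add: distrib_right nn_integral_add nn_integral_cmult_indicator)
      also have "(\<integral>\<^sup>+y\<in>U i. min (gi i y) L \<partial>M) \<le> ennreal \<phi> * emeasure M (U i)"
        using IH[OF t, of "c i"] True t \<phi> by (simp add: U_def gi_def emeasure_ball ennreal_mult)
      finally show ?thesis
        using \<phi> k1 N by (simp add: distrib_right add_right_mono)
    qed (simp add: U_def)
    have "(\<integral>\<^sup>+y\<in>ball x0 r. min (local_max f x0 r y) L \<partial>M) \<le>
       (\<integral>\<^sup>+y. ennreal lam * indicator (ball x0 r) y +
        (\<Sum>i. (min (gi i y) L + ennreal (k1 * N)) * indicator (U i) y) \<partial>M)"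
      by (intro nn_integral_mono point)
    also have "\<dots> = ennreal lam * emeasure M (ball x0 r) +
        (\<Sum>i. \<integral>\<^sup>+y. (min (gi i y) L + ennreal (k1 * N)) * indicator (U i) y \<partial>M)"
      by (subst nn_integral_add) (auto simp: nn_integral_cmult_indicator nn_integral_suminf)
    also have "\<dots> \<le> ennreal lam * ennreal (vol M r x0) + (\<Sum>i. ennreal (\<phi> + k1 * N) * emeasure M (U i))"
      using r by (intro add_mono suminf_le allI piece) (auto simp: emeasure_ball)
    also have "\<dots> \<le> ennreal lam * ennreal (vol M r x0) + ennreal (\<phi> + k1 * N) * ennreal (vol M r x0 / 2)"
      unfolding ennreal_suminf_cmult by (intro add_left_mono mult_left_mono half) auto
    also have "\<dots> = ennreal (lam * vol M r x0 + (\<phi> + k1 * N) * (vol M r x0 / 2))"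
      using \<phi> k1 N W K by (simp add: lam_def ennreal_mult[symmetric] ennreal_plus[symmetric] del: ennreal_plus)
    also have "lam * vol M r x0 + (\<phi> + k1 * N) * (vol M r x0 / 2) = (k * N + \<phi> / 2) * vol M r x0"
      by (simp add: lam_def k_def field_simps)
    finally show ?thesis .
  qed
  then show ?thesis using k by (intro exI[of _ k]) blast
qed

lemma SUP_min_of_nat: "(SUP n. min g (of_nat n)) = (g :: ennreal)"
proof (rule antisym)
  show "g \<le> (SUP n. min g (of_nat n))"
  proof (cases "g = top")
    case True then show ?thesis by (simp add: min_absorb2 ennreal_SUP_of_nat_eq_top)
  next
    case False
    then obtain n where "g < of_nat n" using ennreal_Ex_less_of_nat less_top by blast
    then show ?thesis by (intro SUP_upper2[of n]) (auto simp: min_def)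
  qed
qed (auto intro: SUP_least)

text \<open>Truncation at \<open>n\<close> supplies the trivial bound \<open>n\<close> to start from; \<open>m\<close> applications of the stopping
  time step turn it into \<open>2kN + n / 2^m\<close>. The limit over \<open>m\<close> does not depend on \<open>n\<close>, and monotone
  convergence removes the truncation.\<close>

lemma local_max_mean:
  "\<exists>C>0. \<forall>f N x r. osc_bound f N \<longrightarrow> 0 < r \<longrightarrow>
     (\<integral>\<^sup>+y\<in>ball x r. local_max f x r y \<partial>M) \<le> ennreal (C * N * vol M r x)"
proof -
  obtain k where k: "0 < k" and step: "\<And>f N L \<phi> x r. osc_bound f N \<Longrightarrow> 0 \<le> \<phi> \<Longrightarrow> 0 < r \<Longrightarrow>
     (\<And>x r. 0 < r \<Longrightarrow> (\<integral>\<^sup>+y\<in>ball x r. min (local_max f x r y) L \<partial>M) \<le> ennreal (\<phi> * vol M r x)) \<Longrightarrow>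
     (\<integral>\<^sup>+y\<in>ball x r. min (local_max f x r y) L \<partial>M) \<le> ennreal ((k * N + \<phi> / 2) * vol M r x)"
    using stopping_time_step by blast
  have trunc: "(\<integral>\<^sup>+y\<in>ball x r. min (local_max f x r y) (of_nat n) \<partial>M) \<le> ennreal (2 * k * N * vol M r x)"
    if f: "osc_bound f N" and r: "0 < r" for f N x r n
  proof -
    have N: "0 < N" using f by (simp add: osc_bound_def)
    have "\<forall>x r. 0 < r \<longrightarrow> (\<integral>\<^sup>+y\<in>ball x r. min (local_max f x r y) (of_nat n) \<partial>M)
        \<le> ennreal ((2 * k * N + real n / 2 ^ m) * vol M r x)" for m
    proof (induction m)
      case 0
      show ?case
      proof (intro allI impI)
        fix x and r :: real assume r: "0 < r"
        have "(\<integral>\<^sup>+y\<in>ball x r. min (local_max f x r y) (of_nat n) \<partial>M)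
            \<le> (\<integral>\<^sup>+y. of_nat n * indicator (ball x r) y \<partial>M)"
          by (intro nn_integral_mono mult_right_mono) auto
        also have "\<dots> = ennreal (real n * vol M r x)"
          using r by (simp add: nn_integral_cmult_indicator emeasure_ball ennreal_mult
              flip: ennreal_of_nat_eq_real_of_nat)
        also have "\<dots> \<le> ennreal ((2 * k * N + real n / 2 ^ 0) * vol M r x)"
          using k N by (intro ennreal_leI mult_right_mono) auto
        finally show "(\<integral>\<^sup>+y\<in>ball x r. min (local_max f x r y) (of_nat n) \<partial>M)
            \<le> ennreal ((2 * k * N + real n / 2 ^ 0) * vol M r x)" .
      qed
    next
      case (Suc m)
      have eq: "k * N + (2 * k * N + real n / 2 ^ m) / 2 = 2 * k * N + real n / 2 ^ Suc m"
        by (simp add: field_simps)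
      show ?case
        unfolding eq[symmetric] using k N Suc by (intro allI impI step[OF f]) auto
    qed
    then have bound: "(\<integral>\<^sup>+y\<in>ball x r. min (local_max f x r y) (of_nat n) \<partial>M)
        \<le> ennreal ((2 * k * N + real n / 2 ^ m) * vol M r x)" for m
      using r by blast
    have lim: "(\<lambda>m. (2 * k * N + real n / 2 ^ m) * vol M r x) \<longlonglongrightarrow> (2 * k * N + 0) * vol M r x"
      by (intro tendsto_intros LIMSEQ_divide_realpow_zero) auto
    show ?thesis
      using LIMSEQ_le_const[OF tendsto_ennrealI[OF lim]] bound by simp
  qed
  have "(\<integral>\<^sup>+y\<in>ball x r. local_max f x r y \<partial>M) \<le> ennreal (2 * k * N * vol M r x)"
    if f: "osc_bound f N" and r: "0 < r" for f N x r
  proof -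
    note [measurable] = local_max_measurable[OF f]
    have inc: "incseq (\<lambda>n y. min (local_max f x r y) (of_nat n) * indicator (ball x r) y)"
      unfolding incseq_def le_fun_def by (intro allI impI mult_right_mono min.mono) auto
    have "(\<integral>\<^sup>+y\<in>ball x r. local_max f x r y \<partial>M)
      = (\<integral>\<^sup>+y. (SUP n. min (local_max f x r y) (of_nat n) * indicator (ball x r) y) \<partial>M)"
      unfolding SUP_mult_right_ennreal[symmetric] SUP_min_of_nat ..
    also have "\<dots> = (SUP n. \<integral>\<^sup>+y\<in>ball x r. min (local_max f x r y) (of_nat n) \<partial>M)"
      using inc by (intro nn_integral_monotone_convergence_SUP) auto
    also have "\<dots> \<le> ennreal (2 * k * N * vol M r x)"
      by (intro SUP_least trunc f r)
    finally show ?thesis .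
  qed
  then show ?thesis using k by (intro exI[of _ "2 * k"]) auto
qed

end

section \<open>The radial maximal function\<close>

text \<open>At distances at most \<open>\<rho> y\<close> the power in the admissibility condition is bounded by a constant.\<close>

lemma admissible_comparable:
  assumes "admissible \<rho>"
  obtains c where "1 \<le> c" "\<And>x y. dist x y \<le> \<rho> y \<Longrightarrow> \<rho> y \<le> c * \<rho> x"
proof -
  obtain C0 k0 where pos: "\<And>x. 0 < \<rho> x" and C: "0 < C0" "0 < k0"
    and adm: "\<And>x y. 1 / \<rho> x \<le> C0 * (1 / \<rho> y) * (1 + dist x y / \<rho> y) powr k0"
    using assms unfolding admissible_def by blast
  show ?thesis
  proof
    fix x y assume d: "dist x y \<le> \<rho> y"
    have "(1 + dist x y / \<rho> y) powr k0 \<le> 2 powr k0"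
      using d pos[of y] C by (intro powr_mono2) (auto simp: add_nonneg_nonneg)
    then have "C0 * (1 / \<rho> y) * (1 + dist x y / \<rho> y) powr k0 \<le> C0 * (1 / \<rho> y) * 2 powr k0"
      using C pos[of y] by (intro mult_left_mono) auto
    with adm[of x y] have "1 / \<rho> x \<le> C0 * (1 / \<rho> y) * 2 powr k0" by simp
    then have "\<rho> y \<le> C0 * 2 powr k0 * \<rho> x"
      using pos[of x] pos[of y] by (simp add: field_simps)
    also have "\<dots> \<le> max 1 (C0 * 2 powr k0) * \<rho> x"
      using pos[of x] by (intro mult_right_mono) auto
    finally show "\<rho> y \<le> max 1 (C0 * 2 powr k0) * \<rho> x" .
  qed simp
qed

lemma (in doubling_measure) nn_set_mean_le_iff:
  assumes r: "0 < r" and N: "0 \<le> N"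
  shows "nn_set_mean M (ball x r) g \<le> ennreal N \<longleftrightarrow>
    (\<integral>\<^sup>+y\<in>ball x r. g y \<partial>M) \<le> ennreal (N * vol M r x)"
proof (cases "\<integral>\<^sup>+y\<in>ball x r. g y \<partial>M")
  case (real i)
  then show ?thesis
    using vol_pos[OF r, of x] N r
    by (simp add: nn_set_mean_def emeasure_ball divide_ennreal pos_divide_le_eq)
next
  case top
  then show ?thesis
    using r by (simp add: nn_set_mean_def emeasure_ball ennreal_top_divide top_unique)
qed

locale localized_approx_identity = approx_identity M A \<epsilon>1 \<epsilon>2 A4 S
  for M :: "'a::metric_space measure" and A \<epsilon>1 \<epsilon>2 A4 :: real and S +
  fixes \<rho> :: "'a \<Rightarrow> real" and c :: real
  assumes rho_pos: "0 < \<rho> x" and rho_measurable [measurable]: "\<rho> \<in> borel_measurable M"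
    and c: "1 \<le> c" and rho_le: "dist x y \<le> \<rho> y \<Longrightarrow> \<rho> y \<le> c * \<rho> x"
begin

abbreviation R :: "('a \<Rightarrow> complex) \<Rightarrow> 'a \<Rightarrow> ennreal" where
  "R f \<equiv> radial_maximal M S \<rho> f"

text \<open>The supremum over \<open>t < q\<close> is lower semicontinuous for each fixed \<open>q\<close> and left continuous in \<open>q\<close>.
  The value at \<open>q = \<rho> x\<close> is therefore the supremum over the rational numbers below \<open>\<rho> x\<close>.\<close>

lemma radial_measurable:
  assumes f: "osc_bound f N"
  shows "R f \<in> borel_measurable M"
proof -
  define h where "h q x = (SUP t\<in>{0<..<q}. ennreal (cmod (T t f x - 0)))" for q x
  have [measurable]: "h q \<in> borel_measurable M" for q
    unfolding h_def[abs_def] by (rule SUP_T_measurable[OF f]) auto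
  have "R f x = (SUP q. if of_rat q < \<rho> x then h (of_rat q) x else 0)" for x
  proof (rule antisym)
    show "R f x \<le> (SUP q. if of_rat q < \<rho> x then h (of_rat q) x else 0)"
      unfolding radial_maximal_def
    proof (rule SUP_least)
      fix t assume t: "t \<in> {0<..<\<rho> x}"
      then obtain q where q: "t < of_rat q" "of_rat q < \<rho> x" using of_rat_dense by auto
      then have "ennreal (cmod (T t f x)) \<le> h (of_rat q) x"
        unfolding h_def using t by (intro SUP_upper2[of t]) auto
      then show "ennreal (cmod (T t f x)) \<le> (SUP q. if of_rat q < \<rho> x then h (of_rat q) x else 0)"
        using q by (intro SUP_upper2[of q]) auto
    qed
    show "(SUP q. if of_rat q < \<rho> x then h (of_rat q) x else 0) \<le> R f x"
      unfolding radial_maximal_def h_def by (intro SUP_least) (auto intro!: SUP_subset_mono)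
  qed
  then have "R f = (\<lambda>x. SUP q. if of_rat q < \<rho> x then h (of_rat q) x else 0)" by auto
  also have "\<dots> \<in> borel_measurable M" by measurable
  finally show ?thesis .
qed

definition bmo_bound :: "('a \<Rightarrow> complex) \<Rightarrow> real \<Rightarrow> bool" where
  "bmo_bound f N \<longleftrightarrow> osc_bound f N \<and> (\<forall>x r. \<rho> x \<le> r \<longrightarrow> cmod (avg f x r) \<le> N)"

lemma bmo_bound_of_norm:
  assumes f: "f \<in> L1_loc M" and N: "0 < N" and norm: "bmo_norm M \<rho> f \<le> ennreal N"
  shows "bmo_bound f (2 * N)"
proof -
  have small: "(\<integral>\<^sup>+y\<in>ball x r. ennreal (cmod (f y - avg f x r)) \<partial>M) \<le> ennreal (N * vol M r x)"
    if "0 < r" "r < \<rho> x" for x r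
  proof -
    have "nn_set_mean M (ball x r) (\<lambda>y. ennreal (cmod (f y - avg f x r))) \<le> bmo_norm M \<rho> f"
      unfolding bmo_norm_def using that
      by (intro add_increasing2[OF zero_le] SUP_upper2[of "(x, r)"]) (auto simp: small_balls_def)
    then show ?thesis using norm N that by (simp add: nn_set_mean_le_iff[symmetric])
  qed
  have large: "(\<integral>\<^sup>+y\<in>ball x r. ennreal (cmod (f y - 0)) \<partial>M) \<le> ennreal (N * vol M r x)"
    if "\<rho> x \<le> r" for x r
  proof -
    have r: "0 < r" using that rho_pos[of x] by linarith
    have "nn_set_mean M (ball x r) (\<lambda>y. ennreal (cmod (f y))) \<le> bmo_norm M \<rho> f"
      unfolding bmo_norm_def using that r
      by (intro add_increasing[OF zero_le] SUP_upper2[of "(x, r)"]) (auto simp: large_balls_def)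
    then show ?thesis using norm N r by (simp add: nn_set_mean_le_iff[symmetric])
  qed
  have avg_large: "cmod (avg f x r) \<le> N" if "\<rho> x \<le> r" for x r
    using avg_close[OF f _ order_refl _ large[OF that]] N that rho_pos[of x] by simp
  have "(\<integral>\<^sup>+y\<in>ball x r. ennreal (cmod (f y - avg f x r)) \<partial>M) \<le> ennreal (2 * N * vol M r x)"
    if r: "0 < r" for x r
  proof (cases "\<rho> x \<le> r")
    case True
    have "(\<integral>\<^sup>+y\<in>ball x r. ennreal (cmod (f y - avg f x r)) \<partial>M)
        \<le> ennreal ((N + cmod (0 - avg f x r)) * vol M r x)"
      using N by (intro nn_integral_shift_constant f r large True) auto
    also have "\<dots> \<le> ennreal (2 * N * vol M r x)"
      using avg_large[OF True] by (intro ennreal_leI mult_right_mono) auto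
    finally show ?thesis .
  next
    case False
    then have "(\<integral>\<^sup>+y\<in>ball x r. ennreal (cmod (f y - avg f x r)) \<partial>M) \<le> ennreal (N * vol M r x)"
      using r by (intro small) auto
    also have "\<dots> \<le> ennreal (2 * N * vol M r x)"
      using N by (intro ennreal_leI mult_right_mono) auto
    finally show ?thesis .
  qed
  then have "osc_bound f (2 * N)" using f N by (simp add: osc_bound_def)
  moreover have "cmod (avg f x r) \<le> 2 * N" if "\<rho> x \<le> r" for x r
    using avg_large[OF that] N by linarith
  ultimately show ?thesis by (simp add: bmo_bound_def)
qed

text \<open>On \<open>B(x,r)\<close> with \<open>r \<ge> \<rho> x\<close> the function \<open>\<rho>\<close> is at most \<open>cr\<close>. So the radial maximal function is
  controlled by the local one of the ball \<open>B(x, cr)\<close> and by the mean over this ball, which is itself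
  bounded since the ball is large.\<close>

lemma radial_mean_large:
  "\<exists>C>0. \<forall>f N x r. bmo_bound f N \<longrightarrow> \<rho> x \<le> r \<longrightarrow>
     (\<integral>\<^sup>+y\<in>ball x r. R f y \<partial>M) \<le> ennreal (C * N * vol M r x)"
proof -
  obtain C where C: "0 < C" "\<And>f N x r. osc_bound f N \<Longrightarrow> 0 < r \<Longrightarrow>
     (\<integral>\<^sup>+y\<in>ball x r. local_max f x r y \<partial>M) \<le> ennreal (C * N * vol M r x)"
    using local_max_mean by blast
  obtain K where K: "1 \<le> K" "\<And>x r. 0 < r \<Longrightarrow> vol M (c * r) x \<le> K * vol M r x"
    using vol_dilate by blast
  have "(\<integral>\<^sup>+y\<in>ball x r. R f y \<partial>M) \<le> ennreal ((C + 1) * K * N * vol M r x)"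
    if bf: "bmo_bound f N" and r: "\<rho> x \<le> r" for f N x r
  proof -
    have f: "osc_bound f N" and N: "0 < N" using bf by (auto simp: bmo_bound_def osc_bound_def)
    note [measurable] = local_max_measurable[OF f]
    have r0: "0 < r" using r rho_pos[of x] by linarith
    have cr: "r \<le> c * r" using c r0 by simp
    have "R f y * indicator (ball x r) y
        \<le> local_max f x (c * r) y * indicator (ball x (c * r)) y + ennreal N * indicator (ball x (c * r)) y" for y
    proof (cases "y \<in> ball x r")
      case True
      have "\<rho> y \<le> c * r"
      proof (cases "dist x y \<le> \<rho> y")
        case True
        then have "\<rho> y \<le> c * \<rho> x" by (rule rho_le)
        also have "\<dots> \<le> c * r" using c r by (intro mult_left_mono) auto
        finally show ?thesis .
      qed (use True cr in auto)
      have "R f y \<le> local_max f x (c * r) y + ennreal N"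
        unfolding radial_maximal_def
      proof (rule SUP_least)
        fix t assume t: "t \<in> {0<..<\<rho> y}"
        have "cmod (avg f x (c * r)) \<le> N" using bf r cr by (auto simp: bmo_bound_def)
        then have "cmod (T t f y) \<le> cmod (T t f y - avg f x (c * r)) + N"
          using norm_triangle_sub[of "T t f y" "avg f x (c * r)"] by linarith
        then have "ennreal (cmod (T t f y)) \<le> ennreal (cmod (T t f y - avg f x (c * r))) + ennreal N"
          using N by (simp add: ennreal_leI flip: ennreal_plus)
        also have "\<dots> \<le> local_max f x (c * r) y + ennreal N"
          unfolding local_max_def using t \<open>\<rho> y \<le> c * r\<close> by (intro add_right_mono SUP_upper) auto
        finally show "ennreal (cmod (T t f y)) \<le> local_max f x (c * r) y + ennreal N" .
      qed
      then show ?thesis using True cr by simp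
    qed simp
    then have "(\<integral>\<^sup>+y\<in>ball x r. R f y \<partial>M) \<le> (\<integral>\<^sup>+y. local_max f x (c * r) y * indicator (ball x (c * r)) y
        + ennreal N * indicator (ball x (c * r)) y \<partial>M)"
      by (intro nn_integral_mono)
    also have "\<dots> = (\<integral>\<^sup>+y\<in>ball x (c * r). local_max f x (c * r) y \<partial>M) + ennreal N * emeasure M (ball x (c * r))"
      by (subst nn_integral_add) (auto simp: nn_integral_cmult_indicator)
    also have "\<dots> \<le> ennreal (C * N * vol M (c * r) x) + ennreal N * ennreal (vol M (c * r) x)"
      using r0 cr by (intro add_mono C f) (auto simp: emeasure_ball)
    also have "\<dots> = ennreal ((C + 1) * N * vol M (c * r) x)"
      using N C by (simp add: ennreal_mult[symmetric] distrib_right flip: ennreal_plus)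
    also have "\<dots> \<le> ennreal ((C + 1) * N * (K * vol M r x))"
      using N C K(2)[OF r0] by (intro ennreal_leI mult_left_mono) auto
    finally show ?thesis by (simp add: ac_simps)
  qed
  moreover have "0 < (C + 1) * K" using C K by simp
  ultimately show ?thesis by blast
qed

text \<open>For \<open>t \<le> r\<close>, \<open>S\<^sub>t f y\<close> differs from the mean over the ball by at most the local maximal function, and
  the mean is seen from \<open>z\<close> at a scale comparable with \<open>r\<close>. For \<open>t > r\<close>, the points \<open>y\<close> and \<open>z\<close> are close
  on the scale \<open>t\<close>, and the value at \<open>y\<close> is comparable with one at \<open>z\<close>. Division of the scale by \<open>c\<^sup>2\<close> makes
  it smaller than \<open>\<rho> z\<close>, because \<open>\<rho>\<close> varies on the ball by at most this factor.\<close>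

lemma radial_le_local_max:
  "\<exists>k>0. \<forall>f N x r y z. osc_bound f N \<longrightarrow> 0 < r \<longrightarrow> r < \<rho> x \<longrightarrow> y \<in> ball x r \<longrightarrow> z \<in> ball x r \<longrightarrow>
     R f y \<le> local_max f x r y + ennreal (k * N) + R f z"
proof -
  have cc: "1 \<le> c * c" "c \<le> c * c" using c mult_mono[of 1 c 1 c] by auto
  obtain K where K: "0 < K"
    and TA: "\<And>f N x y r s. osc_bound f N \<Longrightarrow> 0 < r \<Longrightarrow> 0 < s \<Longrightarrow>
     dist x y \<le> 2 * (c * c) * r \<Longrightarrow> s \<le> 2 * (c * c) * r \<Longrightarrow> r \<le> 2 * (c * c) * s \<Longrightarrow>
     cmod (T r f x - avg f y s) \<le> K * N"
    and TT: "\<And>f N x y r s. osc_bound f N \<Longrightarrow> 0 < r \<Longrightarrow> 0 < s \<Longrightarrow>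
     dist x y \<le> 2 * (c * c) * r \<Longrightarrow> s \<le> 2 * (c * c) * r \<Longrightarrow> r \<le> 2 * (c * c) * s \<Longrightarrow>
     cmod (T r f x - T s f y) \<le> K * N"
    using T_comparable_avg[of "2 * (c * c)"] cc by auto
  have "R f y \<le> local_max f x r y + ennreal (K * N) + R f z"
    if f: "osc_bound f N" and r: "0 < r" "r < \<rho> x" and y: "dist x y < r" and z: "dist x z < r"
    for f N x r y z
    unfolding radial_maximal_def[of _ _ _ _ y]
  proof (rule SUP_least)
    fix t assume t: "t \<in> {0<..<\<rho> y}"
    have N: "0 < N" using f by (simp add: osc_bound_def)
    have xz: "\<rho> x \<le> c * \<rho> z" using rho_le[of z x] z r by (simp add: dist_commute)
    have "\<rho> y \<le> c * \<rho> x"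
    proof (cases "dist x y \<le> \<rho> y")
      case False
      have "1 * \<rho> x \<le> c * \<rho> x" using c rho_pos[of x] by (intro mult_right_mono) auto
      then show ?thesis using False y r by linarith
    qed (rule rho_le)
    also have "\<dots> \<le> c * (c * \<rho> z)" using xz c by (intro mult_left_mono) auto
    finally have yz: "\<rho> y \<le> c * c * \<rho> z" by (simp add: mult.assoc)
    have low: "ennreal (cmod (T (u / (c * c)) f z)) \<le> R f z" if "0 < u" "u < c * c * \<rho> z" for u
      unfolding radial_maximal_def using that cc by (intro SUP_upper) (auto simp: field_simps)
    show "ennreal (cmod (T t f y)) \<le> local_max f x r y + ennreal (K * N) + R f z"
    proof (cases "t \<le> r")
      case True
      let ?s = "r / (c * c)"
      have s: "0 < ?s" "?s \<le> r" "c * c * ?s = r" using r cc by (auto simp: field_simps)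
      have "cmod (T ?s f z - avg f x r) \<le> K * N"
      proof (rule TA[OF f s(1) r(1)])
        have eq: "2 * (c * c) * ?s = 2 * r" using s(3) by (metis mult.assoc)
        show "dist z x \<le> 2 * (c * c) * ?s" unfolding eq using z r by (simp add: dist_commute)
        show "r \<le> 2 * (c * c) * ?s" unfolding eq using r by simp
        have "1 * r \<le> 2 * (c * c) * r" using cc r by (intro mult_right_mono) auto
        then show "?s \<le> 2 * (c * c) * r" using s by linarith
      qed
      then have "cmod (T t f y) \<le> cmod (T t f y - avg f x r) + K * N + cmod (T ?s f z)"
        using norm_triangle_sub[of "T t f y" "avg f x r"] norm_triangle_sub[of "avg f x r" "T ?s f z"]
        by (simp add: norm_minus_commute)
      then have "ennreal (cmod (T t f y)) \<le> ennreal (cmod (T t f y - avg f x r)) + ennreal (K * N) + ennreal (cmod (T ?s f z))"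
        using K N by (simp add: ennreal_leI flip: ennreal_plus)
      also have "\<dots> \<le> local_max f x r y + ennreal (K * N) + R f z"
      proof (intro add_mono order_refl)
        show "ennreal (cmod (T t f y - avg f x r)) \<le> local_max f x r y"
          unfolding local_max_def using t True by (intro SUP_upper) auto
        have "c * \<rho> z \<le> c * c * \<rho> z" using cc rho_pos[of z] by (intro mult_right_mono) auto
        then show "ennreal (cmod (T ?s f z)) \<le> R f z" using r xz by (intro low) auto
      qed
      finally show ?thesis .
    next
      case False
      let ?s = "t / (c * c)"
      have s: "0 < ?s" "?s \<le> t" "c * c * ?s = t" using t cc by (auto simp: field_simps)
      have "cmod (T t f y - T ?s f z) \<le> K * N"
      proof (rule TT[OF f _ s(1)])
        have eq: "2 * (c * c) * ?s = 2 * t" using s(3) by (metis mult.assoc)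
        show "t \<le> 2 * (c * c) * ?s" unfolding eq using t by simp
        have "0 < t" using t by simp
        have "2 * 1 * t \<le> 2 * (c * c) * t" using cc t by (intro mult_right_mono) auto
        moreover have "dist y z < 2 * t" using dist_triangle3[of y z x] y z False by linarith
        ultimately show "dist y z \<le> 2 * (c * c) * t" "?s \<le> 2 * (c * c) * t" using s(2) \<open>0 < t\<close> by linarith+
      qed (use t in auto)
      then have "cmod (T t f y) \<le> K * N + cmod (T ?s f z)"
        using norm_triangle_sub[of "T t f y" "T ?s f z"] by linarith
      then have "ennreal (cmod (T t f y)) \<le> ennreal (K * N) + ennreal (cmod (T ?s f z))"
        using K N by (simp add: ennreal_leI flip: ennreal_plus)
      also have "\<dots> \<le> ennreal (K * N) + R f z"
        using t yz by (intro add_left_mono low) auto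
      finally show ?thesis by (simp add: add.assoc add_increasing)
    qed
  qed
  then show ?thesis using K by (intro exI[of _ K]) auto
qed

text \<open>The space is a countable union of large balls with a common centre, and the radial maximal function
  is integrable on each of them.\<close>

lemma radial_finite_AE:
  assumes "bmo_bound f N"
  shows "AE x in M. R f x < \<infinity>"
proof -
  have [measurable]: "R f \<in> borel_measurable M"
    using assms radial_measurable by (auto simp: bmo_bound_def)
  obtain C where C: "\<And>f N x r. bmo_bound f N \<Longrightarrow> \<rho> x \<le> r \<Longrightarrow>
     (\<integral>\<^sup>+y\<in>ball x r. R f y \<partial>M) \<le> ennreal (C * N * vol M r x)"
    using radial_mean_large by blast
  fix z :: 'a
  have "AE y in M. R f y * indicator (ball z (\<rho> z + real k)) y \<noteq> \<infinity>" for k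
  proof (rule nn_integral_PInf_AE)
    have "(\<integral>\<^sup>+y\<in>ball z (\<rho> z + real k). R f y \<partial>M) \<le> ennreal (C * N * vol M (\<rho> z + real k) z)"
      using assms by (intro C) auto
    then show "(\<integral>\<^sup>+y\<in>ball z (\<rho> z + real k). R f y \<partial>M) \<noteq> \<infinity>" by (auto simp: top_unique)
  qed measurable
  then have "AE y in M. \<forall>k. R f y * indicator (ball z (\<rho> z + real k)) y \<noteq> \<infinity>"
    by (simp add: AE_all_countable)
  then show ?thesis
  proof (rule AE_mp, intro AE_I2 impI)
    fix y assume *: "\<forall>k. R f y * indicator (ball z (\<rho> z + real k)) y \<noteq> \<infinity>"
    obtain k where "dist z y < real k" using reals_Archimedean2 by blast
    then have "y \<in> ball z (\<rho> z + real k)" using rho_pos[of z] by simp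
    with *[rule_format, of k] show "R f y < \<infinity>" by (simp add: less_top)
  qed
qed

lemma essinf_ge:
  assumes [measurable]: "g \<in> borel_measurable M" and ae: "AE z in M. z \<in> ball x r \<longrightarrow> m \<le> g z"
  shows "ereal m \<le> essinf_on M (ball x r) g"
proof -
  have "esssup (restrict_space M (ball x r)) (\<lambda>y. - ereal (g y)) \<le> - ereal m"
  proof (rule esssup_I)
    show "(\<lambda>y. - ereal (g y)) \<in> borel_measurable (restrict_space M (ball x r))"
      by (rule measurable_restrict_space1) measurable
    show "AE y in restrict_space M (ball x r). - ereal (g y) \<le> - ereal m"
      using ae by (subst AE_restrict_space_iff) auto
  qed
  then have "- (- ereal m) \<le> - esssup (restrict_space M (ball x r)) (\<lambda>y. - ereal (g y))"
    unfolding ereal_minus_le_minus .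
  then show ?thesis by (simp add: essinf_on_def)
qed

text \<open>In the pointwise comparison between \<open>y\<close> and \<open>z\<close>, the bound holds for almost every \<open>z\<close> with \<open>y\<close> fixed, so
  \<open>z\<close> may be replaced by the essential infimum. What remains is the mean of the local maximal
  function.\<close>

lemma radial_oscillation_small:
  "\<exists>C>0. \<forall>f N x r. bmo_bound f N \<longrightarrow> 0 < r \<longrightarrow> r < \<rho> x \<longrightarrow>
     (\<integral>\<^sup>+y\<in>ball x r. e2ennreal (ereal (enn2real (R f y))
         - essinf_on M (ball x r) (\<lambda>y. enn2real (R f y))) \<partial>M) \<le> ennreal (C * N * vol M r x)"
proof -
  obtain C where C: "0 < C" "\<And>f N x r. osc_bound f N \<Longrightarrow> 0 < r \<Longrightarrow>
     (\<integral>\<^sup>+y\<in>ball x r. local_max f x r y \<partial>M) \<le> ennreal (C * N * vol M r x)"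
    using local_max_mean by blast
  obtain k where k: "0 < k" "\<And>f N x r y z. osc_bound f N \<Longrightarrow> 0 < r \<Longrightarrow> r < \<rho> x \<Longrightarrow>
     y \<in> ball x r \<Longrightarrow> z \<in> ball x r \<Longrightarrow> R f y \<le> local_max f x r y + ennreal (k * N) + R f z"
    using radial_le_local_max by blast
  have "(\<integral>\<^sup>+y\<in>ball x r. e2ennreal (ereal (enn2real (R f y))
         - essinf_on M (ball x r) (\<lambda>y. enn2real (R f y))) \<partial>M) \<le> ennreal ((C + k) * N * vol M r x)"
    if bf: "bmo_bound f N" and r: "0 < r" "r < \<rho> x" for f N x r
  proof -
    have f: "osc_bound f N" and N: "0 < N" using bf by (auto simp: bmo_bound_def osc_bound_def)
    note [measurable] = local_max_measurable[OF f] radial_measurable[OF f]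
    let ?g = "\<lambda>y. enn2real (R f y)"
    have fin: "AE y in M. R f y < \<infinity>" by (rule radial_finite_AE[OF bf])
    have "AE y in M. local_max f x r y * indicator (ball x r) y \<noteq> \<infinity>"
    proof (rule nn_integral_PInf_AE)
      show "(\<integral>\<^sup>+y\<in>ball x r. local_max f x r y \<partial>M) \<noteq> \<infinity>"
        using C(2)[OF f r(1), of x] by (auto simp: top_unique)
    qed measurable
    with fin have "AE y in M. e2ennreal (ereal (?g y) - essinf_on M (ball x r) ?g) * indicator (ball x r) y
       \<le> local_max f x r y * indicator (ball x r) y + ennreal (k * N) * indicator (ball x r) y"
    proof eventually_elim
      case (elim y)
      show ?case
      proof (cases "y \<in> ball x r")
        case True
        define m where "m = enn2real (local_max f x r y)"
        have m: "local_max f x r y = ennreal m" "0 \<le> m"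
          using elim(2) True by (auto simp: m_def less_top)
        have kN: "0 \<le> k * N" using k N by simp
        have "AE z in M. z \<in> ball x r \<longrightarrow> ?g y - (m + k * N) \<le> ?g z"
          using fin
        proof (rule AE_mp, intro AE_I2 impI)
          fix z assume z: "R f z < \<infinity>" "z \<in> ball x r"
          have "ennreal (?g y) \<le> ennreal m + ennreal (k * N) + ennreal (?g z)"
            using k(2)[OF f r True z(2)] elim(1) z(1) m by simp
          then have "?g y \<le> m + k * N + ?g z"
            using m(2) kN by (simp flip: ennreal_plus)
          then show "?g y - (m + k * N) \<le> ?g z" by simp
        qed
        then have "ereal (?g y - (m + k * N)) \<le> essinf_on M (ball x r) ?g"
          by (intro essinf_ge) measurable
        then have "ereal (?g y) - essinf_on M (ball x r) ?g \<le> ereal (m + k * N)"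
          by (cases "essinf_on M (ball x r) ?g") auto
        then have "e2ennreal (ereal (?g y) - essinf_on M (ball x r) ?g) \<le> ennreal (m + k * N)"
          using e2ennreal_mono by (fastforce simp: ennreal.abs_eq)
        then show ?thesis using True m kN by simp
      qed simp
    qed
    then have "(\<integral>\<^sup>+y\<in>ball x r. e2ennreal (ereal (?g y) - essinf_on M (ball x r) ?g) \<partial>M)
       \<le> (\<integral>\<^sup>+y. local_max f x r y * indicator (ball x r) y + ennreal (k * N) * indicator (ball x r) y \<partial>M)"
      by (rule nn_integral_mono_AE)
    also have "\<dots> = (\<integral>\<^sup>+y\<in>ball x r. local_max f x r y \<partial>M) + ennreal (k * N) * emeasure M (ball x r)"
      by (subst nn_integral_add) (auto simp: nn_integral_cmult_indicator)
    also have "\<dots> \<le> ennreal (C * N * vol M r x) + ennreal (k * N) * ennreal (vol M r x)"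
      using r by (intro add_mono C f) (auto simp: emeasure_ball)
    also have "\<dots> = ennreal ((C + k) * N * vol M r x)"
      using N C k by (simp add: ennreal_mult[symmetric] distrib_right flip: ennreal_plus)
    finally show ?thesis .
  qed
  then show ?thesis using C(1) k(1) by (intro exI[of _ "C + k"]) auto
qed

lemma radial_L1_loc:
  assumes bf: "bmo_bound f N"
  shows "(\<lambda>x. enn2real (R f x)) \<in> L1_loc M"
  unfolding L1_loc_def set_integrable_def
proof (safe, rule integrableI_bounded)
  fix x and r :: real assume r: "0 < r"
  have [measurable]: "R f \<in> borel_measurable M"
    using bf radial_measurable by (auto simp: bmo_bound_def)
  show "(\<lambda>y. indicator (ball x r) y *\<^sub>R enn2real (R f y)) \<in> borel_measurable M" by measurable
  obtain C where C: "\<And>f N x r. bmo_bound f N \<Longrightarrow> \<rho> x \<le> r \<Longrightarrow>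
     (\<integral>\<^sup>+y\<in>ball x r. R f y \<partial>M) \<le> ennreal (C * N * vol M r x)"
    using radial_mean_large by blast
  define s where "s = max r (\<rho> x)"
  have "(\<integral>\<^sup>+y. ennreal (norm (indicator (ball x r) y *\<^sub>R enn2real (R f y))) \<partial>M) \<le> (\<integral>\<^sup>+y\<in>ball x s. R f y \<partial>M)"
    by (intro nn_integral_mono) (auto simp: indicator_def s_def ennreal_enn2real_if)
  also have "\<dots> \<le> ennreal (C * N * vol M s x)" by (intro C bf) (simp add: s_def)
  also have "\<dots> < \<infinity>" by simp
  finally show "(\<integral>\<^sup>+y. ennreal (norm (indicator (ball x r) y *\<^sub>R enn2real (R f y))) \<partial>M) < \<infinity>" .
qed

lemma radial_blo_norm:
  "\<exists>C>0. \<forall>f N. bmo_bound f N \<longrightarrow> blo_norm M \<rho> (\<lambda>x. enn2real (R f x)) \<le> ennreal (C * N)"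
proof -
  obtain C1 where C1: "0 < C1" "\<And>f N x r. bmo_bound f N \<Longrightarrow> 0 < r \<Longrightarrow> r < \<rho> x \<Longrightarrow>
     (\<integral>\<^sup>+y\<in>ball x r. e2ennreal (ereal (enn2real (R f y))
         - essinf_on M (ball x r) (\<lambda>y. enn2real (R f y))) \<partial>M) \<le> ennreal (C1 * N * vol M r x)"
    using radial_oscillation_small by blast
  obtain C2 where C2: "0 < C2" "\<And>f N x r. bmo_bound f N \<Longrightarrow> \<rho> x \<le> r \<Longrightarrow>
     (\<integral>\<^sup>+y\<in>ball x r. R f y \<partial>M) \<le> ennreal (C2 * N * vol M r x)"
    using radial_mean_large by blast
  have "blo_norm M \<rho> (\<lambda>x. enn2real (R f x)) \<le> ennreal ((C1 + C2) * N)" if bf: "bmo_bound f N" for f N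
  proof -
    have N: "0 < N" using bf by (auto simp: bmo_bound_def osc_bound_def)
    have "blo_norm M \<rho> (\<lambda>x. enn2real (R f x)) \<le> ennreal (C1 * N) + ennreal (C2 * N)"
      unfolding blo_norm_def
    proof (intro add_mono SUP_least; clarify)
      fix x r assume xr: "(x, r) \<in> small_balls \<rho>"
      then show "nn_set_mean M (ball x r) (\<lambda>y. e2ennreal (ereal (enn2real (R f y))
         - essinf_on M (ball x r) (\<lambda>x. enn2real (R f x)))) \<le> ennreal (C1 * N)"
        using C1 N bf by (subst nn_set_mean_le_iff) (auto simp: small_balls_def)
    next
      fix x r assume xr: "(x, r) \<in> large_balls \<rho>"
      have "(\<integral>\<^sup>+y\<in>ball x r. ennreal \<bar>enn2real (R f y)\<bar> \<partial>M) \<le> (\<integral>\<^sup>+y\<in>ball x r. R f y \<partial>M)"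
        by (intro nn_integral_mono mult_right_mono) (auto simp: ennreal_enn2real_if)
      also have "\<dots> \<le> ennreal (C2 * N * vol M r x)"
        using xr by (intro C2 bf) (simp add: large_balls_def)
      finally show "nn_set_mean M (ball x r) (\<lambda>y. ennreal \<bar>enn2real (R f y)\<bar>) \<le> ennreal (C2 * N)"
        using xr C2(1) N by (subst nn_set_mean_le_iff) (auto simp: large_balls_def)
    qed
    then show ?thesis using C1(1) C2(1) N by (simp add: distrib_right)
  qed
  then show ?thesis using C1(1) C2(1) by (intro exI[of _ "C1 + C2"]) auto
qed

lemma radial_BMO_BLO:
  "\<exists>C>0. \<forall>f\<in>BMO M \<rho>. (AE x in M. R f x < \<infinity>) \<and> (\<lambda>x. enn2real (R f x)) \<in> BLO M \<rho> \<and>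
     blo_norm M \<rho> (\<lambda>x. enn2real (R f x)) \<le> ennreal C * bmo_norm M \<rho> f"
proof -
  obtain C where C: "0 < C" "\<And>f N. bmo_bound f N \<Longrightarrow> blo_norm M \<rho> (\<lambda>x. enn2real (R f x)) \<le> ennreal (C * N)"
    using radial_blo_norm by blast
  have "(AE x in M. R f x < \<infinity>) \<and> (\<lambda>x. enn2real (R f x)) \<in> BLO M \<rho> \<and>
     blo_norm M \<rho> (\<lambda>x. enn2real (R f x)) \<le> ennreal (2 * C) * bmo_norm M \<rho> f" if "f \<in> BMO M \<rho>" for f
  proof -
    have f: "f \<in> L1_loc M" and "bmo_norm M \<rho> f < \<infinity>" using that by (auto simp: BMO_def)
    then obtain b where b: "bmo_norm M \<rho> f = ennreal b" "0 \<le> b"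
      by (cases "bmo_norm M \<rho> f") auto
    \<comment> \<open>A bound must be positive, so the norm \<open>b\<close>, which may be 0, is enlarged by \<open>e\<close>; letting \<open>e\<close> tend to 0 recovers \<open>b\<close>.\<close>
    have bound: "bmo_bound f (2 * (b + e))" if "0 < e" for e
      using that b by (intro bmo_bound_of_norm f) (auto simp: ennreal_leI)
    have "blo_norm M \<rho> (\<lambda>x. enn2real (R f x)) \<le> ennreal (2 * C * b)"
    proof (rule ennreal_le_epsilon)
      fix e :: real assume e: "0 < e"
      have "C * (2 * (b + e / (2 * C))) = 2 * C * b + e" using C(1) by (simp add: field_simps)
      then show "blo_norm M \<rho> (\<lambda>x. enn2real (R f x)) \<le> ennreal (2 * C * b) + ennreal e"
        using C(2)[OF bound[of "e / (2 * C)"]] C(1) b(2) e by (simp flip: ennreal_plus)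
    qed
    then have blo: "blo_norm M \<rho> (\<lambda>x. enn2real (R f x)) \<le> ennreal (2 * C) * bmo_norm M \<rho> f"
      using C(1) b by (simp add: ennreal_mult)
    moreover have "\<dots> < \<infinity>" using b by (simp add: ennreal_mult_less_top)
    ultimately show ?thesis
      using radial_finite_AE[OF bound[of 1]] radial_L1_loc[OF bound[of 1]]
      by (auto simp: BLO_def intro: le_less_trans)
  qed
  then show ?thesis using C(1) by (intro exI[of _ "2 * C"]) auto
qed

end

theorem corollary5p1:
  fixes M :: "'a::metric_space measure"
    and \<rho> :: "'a \<Rightarrow> real"
    and \<epsilon>1 \<epsilon>2 :: real
    and S :: "real \<Rightarrow> 'a \<Rightarrow> 'a \<Rightarrow> complex"
  assumes "RD_space M"
    and "admissible \<rho>"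
    and "\<rho> \<in> borel_measurable M"
    and "0 < \<epsilon>1" "\<epsilon>1 \<le> 1" "0 < \<epsilon>2"
    and "continuous_approx_identity M \<epsilon>1 \<epsilon>2 S"
  shows "\<exists>C>0. \<forall>f\<in>BMO M \<rho>.
    (AE x in M. radial_maximal M S \<rho> f x < \<infinity>) \<and>
    (\<lambda>x. enn2real (radial_maximal M S \<rho> f x)) \<in> BLO M \<rho> \<and>
    blo_norm M \<rho> (\<lambda>x. enn2real (radial_maximal M S \<rho> f x)) \<le> ennreal C * bmo_norm M \<rho> f"
proof -
  have sets: "sets M = sets borel"
    and balls: "\<And>r x. 0 < r \<Longrightarrow> 0 < emeasure M (ball x r)"
      "\<And>r x. 0 < r \<Longrightarrow> emeasure M (ball x r) < \<infinity>"
    using assms(1) unfolding RD_space_def regular_borel_def by blast+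
  obtain A where A: "1 \<le> A" "\<And>x r. 0 < r \<Longrightarrow> vol M (2 * r) x \<le> A * vol M r x"
    using assms(1) unfolding RD_space_def by blast
  obtain c where c: "1 \<le> c" "\<And>x y. dist x y \<le> \<rho> y \<Longrightarrow> \<rho> y \<le> c * \<rho> x"
    using admissible_comparable[OF assms(2)] by blast
  have meas: "\<And>t. 0 < t \<Longrightarrow> case_prod (S t) \<in> borel_measurable (M \<Otimes>\<^sub>M M)"
    using assms(7) unfolding continuous_approx_identity_def by blast
  obtain A4 where A4: "0 < A4" and kernel: "\<forall>t>0.
        (\<forall>x y. cmod (S t x y) \<le> A4 * cai_bound M \<epsilon>2 t x y) \<and>
        (\<forall>x x' y. dist x x' \<le> (t + dist x y) / 2 \<longrightarrow>
           cmod (S t x y - S t x' y)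
             \<le> A4 * (dist x x' / (t + dist x y)) powr \<epsilon>1 * cai_bound M \<epsilon>2 t x y) \<and>
        (\<forall>x y y'. dist y y' \<le> (t + dist x y) / 2 \<longrightarrow>
           cmod (S t x y - S t x y')
             \<le> A4 * (dist y y' / (t + dist x y)) powr \<epsilon>1 * cai_bound M \<epsilon>2 t x y) \<and>
        (\<forall>x. has_bochner_integral M (\<lambda>z. S t x z) 1) \<and>
        (\<forall>y. has_bochner_integral M (\<lambda>z. S t z y) 1)"
    using assms(7) unfolding continuous_approx_identity_def by (elim conjE exE) (rule that)
  have size: "cmod (S t x y) \<le> A4 * cai_bound M \<epsilon>2 t x y"
    and smooth: "dist x x' \<le> (t + dist x y) / 2 \<Longrightarrow> cmod (S t x y - S t x' y)
      \<le> A4 * (dist x x' / (t + dist x y)) powr \<epsilon>1 * cai_bound M \<epsilon>2 t x y"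
    and mass: "has_bochner_integral M (S t x) 1" if "0 < t" for t x x' y
    using kernel[rule_format, OF that] by blast+
  interpret localized_approx_identity M A \<epsilon>1 \<epsilon>2 A4 S \<rho> c
  proof
    show "S t x \<in> borel_measurable M" if "0 < t" for t x
      using measurable_Pair2[OF meas[OF that], of x] sets_eq_imp_space_eq[OF sets] by simp
    show "0 < \<rho> x" for x using assms(2) by (simp add: admissible_def)
  qed (fact sets balls A A4 size smooth mass c assms(3,4,6))+
  show ?thesis by (rule radial_BMO_BLO)
qed

end
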